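(* Let $N\ge1$, and let $V$, $\Delta$, $\mathcal F$, $\mathcal W$ and $\mathcal H_\Omega$ be as in the context. Define the measure $\mu_{c+p}$ on $[-1,1]$ by $$d\mu_{c+p}=\frac{\frac{2}{\pi}\sqrt{1-x^2}}{1-2N^{-1/2}x+N^{-1}}\,dx.$$ Then the restriction of $\mathcal W\Delta\mathcal W^*$ to $\mathcal H_\Omega$ is unitarily equivalent to the operator of multiplication by $N+1-2\sqrt N x$ on $L^2(\mu_{c+p})$.
   Context: $V$ is the set of finite words over $\{1,\dots,N\}$ including the empty word $\emptyset$; the $N$-ary tree has edges exactly the pairs $\{\omega,\omega i\}$ ($\omega i$ is $\omega$ with the letter $i$ appended). $\Delta$ is the graph Laplacian $(\Delta v)(x)=\sum_{y\sim x}(v(x)-v(y))$ on $l^2(V)$ (bounded selfadjoint). Let $H=\mathbb{C}^N$ with orthonormal basis $e_1,\dots,e_N$ and $\mathcal F=\mathbb{C}\Omega\oplus H\oplus H^{\otimes2}\oplus\cdots$ the full Fock space ($\Omega$ a unit vector). $\mathcal W:l^2(V)\to\mathcal F$ is the unitary with $\mathcal W\delta_\emptyset=\Omega$, $\mathcal W\delta_{\omega_1\dots\omega_n}=e_{\omega_1}\otimes\cdots\otimes e_{\omega_n}$. Let $s_0=N^{-1/2}\sum_{i=1}^Ne_i$ and $\mathcal H_\Omega=\overline{\operatorname{span}}\{\Omega,\ s_0^{\otimes p}:p\ge1\}$. *)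

theory Defs
  imports "HOL-Analysis.Analysis"
begin

text \<open>Words over the alphabet {1..N}: the vertex set V of the N-ary tree.
  A word is a list of letters; the word w@[i] is w with the letter i appended.\<close>
definition words :: "nat \<Rightarrow> nat list set" where
  "words N = {w. set w \<subseteq> {1..N}}"

text \<open>Vectors of l^2(V) (and of the full Fock space, see below) are represented by
  complex functions on lists vanishing outside the relevant index set.\<close>
definition l2space :: "nat \<Rightarrow> (nat list \<Rightarrow> complex) set" where
  "l2space N = {v. (\<forall>u. u \<notin> words N \<longrightarrow> v u = 0) \<and>
                   (\<lambda>u. (cmod (v u))\<^sup>2) summable_on words N}"

definition l2norm :: "nat \<Rightarrow> (nat list \<Rightarrow> complex) \<Rightarrow> real" where
  "l2norm N v = sqrt (infsum (\<lambda>u. (cmod (v u))\<^sup>2) (words N))"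

definition tree_laplacian :: "nat \<Rightarrow> (nat list \<Rightarrow> complex) \<Rightarrow> (nat list \<Rightarrow> complex)" where
  "tree_laplacian N v = (\<lambda>x. if x \<in> words N then
      (\<Sum>i\<in>{1..N}. v x - v (x @ [i])) + (if x = [] then 0 else v x - v (butlast x))
    else 0)"

text \<open>Full Fock space over H = C^N: the n-th summand H^{\<otimes>n} has the orthonormal basis
  e_{w1} \<otimes> ... \<otimes> e_{wn}; a Fock vector is given by its coordinates with respect to the
  orthonormal basis {e_w : w word} (e_[] = \<Omega>), i.e. again by a function on words.\<close>
definition fock_basis :: "nat list \<Rightarrow> (nat list \<Rightarrow> complex)" where
  "fock_basis w = (\<lambda>u. if u = w then 1 else 0)"

definition fock_Omega :: "nat list \<Rightarrow> complex" where
  "fock_Omega = fock_basis []"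

text \<open>Vectors of H = C^N are coordinate functions on {1..N}; tensor power x^{\<otimes>p}
  has coordinate x_{w1}*...*x_{wp} at e_{w1}\<otimes>...\<otimes>e_{wp}.\<close>
definition tensor_pow :: "nat \<Rightarrow> (nat \<Rightarrow> complex) \<Rightarrow> nat \<Rightarrow> (nat list \<Rightarrow> complex)" where
  "tensor_pow N x p = (\<lambda>u. if length u = p \<and> set u \<subseteq> {1..N} then (\<Prod>i\<leftarrow>u. x i) else 0)"

definition s0 :: "nat \<Rightarrow> (nat \<Rightarrow> complex)" where
  "s0 N = (\<lambda>i. if i \<in> {1..N} then complex_of_real (1 / sqrt (real N)) else 0)"

text \<open>The unitary W : l^2(V) \<rightarrow> F, W \<delta>_w = e_{w1}\<otimes>...\<otimes>e_{wn}, and its adjoint, in coordinates.\<close>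
definition fock_W :: "nat \<Rightarrow> (nat list \<Rightarrow> complex) \<Rightarrow> (nat list \<Rightarrow> complex)" where
  "fock_W N v = (\<lambda>u. if u \<in> words N then v u else 0)"

definition fock_W_adj :: "nat \<Rightarrow> (nat list \<Rightarrow> complex) \<Rightarrow> (nat list \<Rightarrow> complex)" where
  "fock_W_adj N f = (\<lambda>w. if w \<in> words N then f w else 0)"

definition H_Omega :: "nat \<Rightarrow> (nat list \<Rightarrow> complex) set" where
  "H_Omega N = {f \<in> l2space N. \<forall>e>0. \<exists>(c::nat \<Rightarrow> complex) n.
      l2norm N (\<lambda>u. f u - (c 0 * fock_Omega u + (\<Sum>p\<in>{1..n}. c p * tensor_pow N (s0 N) p u))) < e}"

definition mu_cp :: "nat \<Rightarrow> real measure" where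
  "mu_cp N = density lborel (\<lambda>x. indicator {-1..1} x *
      ennreal ((2 / pi) * sqrt (1 - x\<^sup>2) / (1 - 2 * x / sqrt (real N) + 1 / real N)))"

definition L2fun :: "real measure \<Rightarrow> (real \<Rightarrow> complex) set" where
  "L2fun M = {g. g \<in> borel_measurable M \<and> integrable M (\<lambda>x. (cmod (g x))\<^sup>2)}"

text \<open>Unitary equivalence of an operator T restricted to the (invariant) subspace S of the
  coordinate space with the operator of multiplication by m on L^2(M).  L^2(M) is
  L2fun M modulo equality M-a.e., so U is a map into representatives, and all identities
  in L^2(M) are M-a.e. identities.\<close>
definition unitarily_equiv_mult ::
  "nat \<Rightarrow> (nat list \<Rightarrow> complex) set \<Rightarrow> ((nat list \<Rightarrow> complex) \<Rightarrow> (nat list \<Rightarrow> complex))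
     \<Rightarrow> real measure \<Rightarrow> (real \<Rightarrow> real) \<Rightarrow> bool" where
  "unitarily_equiv_mult N S T M m \<longleftrightarrow>
     (\<forall>f\<in>S. T f \<in> S) \<and>
     (\<exists>U :: (nat list \<Rightarrow> complex) \<Rightarrow> (real \<Rightarrow> complex).
        (\<forall>f\<in>S. U f \<in> L2fun M) \<and>
        (\<forall>f\<in>S. \<forall>g\<in>S. \<forall>a b :: complex.
            AE x in M. U (\<lambda>u. a * f u + b * g u) x = a * U f x + b * U g x) \<and>
        (\<forall>f\<in>S. (LINT x|M. (cmod (U f x))\<^sup>2) = (l2norm N f)\<^sup>2) \<and>
        (\<forall>g\<in>L2fun M. \<exists>f\<in>S. AE x in M. U f x = g x) \<and>
        (\<forall>f\<in>S. AE x in M. U (T f) x = complex_of_real (m x) * U f x))"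

end

theory Submission
  imports Defs
begin

text \<open>
  The space \<open>H_Omega\<close> consists of the square summable radial functions. In the orthonormal basis
  \<open>s\<^sub>0\<^sup>\<otimes>\<^sup>p\<close> the Laplacian acts on it as \<open>N + 1 - 2 \<surd>N J\<close>, where \<open>2 J\<close> is the
  Jacobi matrix with off-diagonal entries 1 and with the single diagonal entry \<open>q = 1/\<surd>N\<close> at the
  origin. The polynomials with this three-term recurrence are \<open>P\<^sub>n = U\<^sub>n - q U\<^sub>n\<^sub>-\<^sub>1\<close>
  (\<open>U\<^sub>n\<close> the Chebyshev polynomials of the second kind), and they are orthonormal for the
  Bernstein--Szego measure \<open>mu_cp\<close>: the recurrence reduces this to \<open>\<integral> P\<^sub>n = 0\<close> for
  \<open>n \<ge> 1\<close>, which follows from \<open>\<integral> 1 = 1\<close> because \<open>P\<^sub>n - q P\<^sub>n\<^sub>+\<^sub>1\<close>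
  is \<open>U\<^sub>n\<close> times the denominator of the density. By Weierstrass approximation an integrable
  function is determined by its coefficients, so \<open>s\<^sub>0\<^sup>\<otimes>\<^sup>p \<mapsto> P\<^sub>p\<close> extends to the
  required unitary by the Riesz--Fischer theorem, and linearity, surjectivity and the intertwining
  relation are all checked on coefficients.
\<close>

section \<open>Bounded orthonormal systems and the Riesz--Fischer theorem\<close>

text \<open>Almost everywhere boundedness of each \<open>P n\<close> makes \<open>g * P n\<close>
  integrable for every integrable \<open>g\<close>, so coefficients exist on all of L1 and not only
  on L2. A bound on the whole line would exclude polynomials.\<close>

locale orthonormal_system = finite_measure M for M :: "real measure" +
  fixes P :: "nat \<Rightarrow> real \<Rightarrow> real"
  assumes P_measurable [measurable]: "\<And>n. P n \<in> borel_measurable M"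
    and P_bounded: "\<And>n. \<exists>C. AE x in M. \<bar>P n x\<bar> \<le> C"
    and orthonormal: "\<And>m n. (LINT x|M. P m x * P n x) = (if m = n then 1 else 0)"
begin

text \<open>The inner product of \<open>g\<close> with \<open>P n\<close>; no conjugate appears
  because \<open>P n\<close> is real-valued.\<close>

definition coeff :: "(real \<Rightarrow> complex) \<Rightarrow> nat \<Rightarrow> complex" where
  "coeff g n = (LINT x|M. g x * complex_of_real (P n x))"

section \<open>Square integrable functions and their coefficients\<close>

lemma L2fun_measurable: "g \<in> L2fun M \<Longrightarrow> g \<in> borel_measurable M"
  by (simp add: L2fun_def)

lemma L2fun_integrable_square: "g \<in> L2fun M \<Longrightarrow> integrable M (\<lambda>x. (cmod (g x))\<^sup>2)"
  by (simp add: L2fun_def)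

lemma L2fun_integrable:
  assumes "g \<in> L2fun M"
  shows "integrable M g"
proof -
  have [measurable]: "g \<in> borel_measurable M" by (rule L2fun_measurable[OF assms])
  have "integrable M (\<lambda>x. cmod (g x))"
    by (rule square_integrable_imp_integrable) (use L2fun_integrable_square[OF assms] in auto)
  then show ?thesis by (simp add: integrable_norm_iff)
qed

lemma integrable_mult_bounded:
  fixes g :: "real \<Rightarrow> complex" and h :: "real \<Rightarrow> real"
  assumes g: "integrable M g" and [measurable]: "h \<in> borel_measurable M"
    and C: "AE x in M. \<bar>h x\<bar> \<le> C"
  shows "integrable M (\<lambda>x. g x * complex_of_real (h x))"
proof (rule Bochner_Integration.integrable_bound)
  show "integrable M (\<lambda>x. complex_of_real C * g x)" using g by auto
  show "(\<lambda>x. g x * complex_of_real (h x)) \<in> borel_measurable M" using g by measurable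
  show "AE x in M. norm (g x * complex_of_real (h x)) \<le> norm (complex_of_real C * g x)"
    using C
  proof eventually_elim
    case (elim x)
    then have "cmod (g x) * \<bar>h x\<bar> \<le> cmod (g x) * \<bar>C\<bar>"
      by (intro mult_left_mono) auto
    then show ?case by (simp add: norm_mult mult.commute)
  qed
qed

lemma integrable_mult_P:
  assumes "integrable M g"
  shows "integrable M (\<lambda>x. g x * complex_of_real (P n x))"
  using P_bounded[of n] integrable_mult_bounded[OF assms P_measurable] by blast

lemma P_integrable: "integrable M (\<lambda>x. complex_of_real (P n x))"
  using integrable_mult_P[of "\<lambda>_. 1" n] by simp

lemma P_P_integrable: "integrable M (\<lambda>x. complex_of_real (P m x) * complex_of_real (P n x))"
  by (rule integrable_mult_P[OF P_integrable])

lemma orthonormal_complex: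
  "(LINT x|M. complex_of_real (P m x) * complex_of_real (P n x)) = (if m = n then 1 else 0)"
  using orthonormal[of m n] by (simp flip: of_real_mult)

lemma L2fun_diff:
  assumes g: "g \<in> L2fun M" and h: "h \<in> L2fun M"
  shows "(\<lambda>x. g x - h x) \<in> L2fun M"
proof -
  have [measurable]: "g \<in> borel_measurable M" "h \<in> borel_measurable M"
    using g h by (auto intro: L2fun_measurable)
  have "integrable M (\<lambda>x. (cmod (g x - h x))\<^sup>2)"
  proof (rule Bochner_Integration.integrable_bound)
    show "integrable M (\<lambda>x. 2 * (cmod (g x))\<^sup>2 + 2 * (cmod (h x))\<^sup>2)"
      using g h by (auto simp: L2fun_def)
    show "AE x in M. norm ((cmod (g x - h x))\<^sup>2) \<le> norm (2 * (cmod (g x))\<^sup>2 + 2 * (cmod (h x))\<^sup>2)"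
    proof (rule AE_I2)
      fix x
      have "(cmod (g x - h x))\<^sup>2 \<le> (cmod (g x) + cmod (h x))\<^sup>2"
        by (intro power_mono norm_triangle_ineq4) auto
      also have "\<dots> \<le> 2 * (cmod (g x))\<^sup>2 + 2 * (cmod (h x))\<^sup>2"
        using zero_le_power2[of "cmod (g x) - cmod (h x)"]
        unfolding power2_diff power2_sum by linarith
      finally show "norm ((cmod (g x - h x))\<^sup>2) \<le> norm (2 * (cmod (g x))\<^sup>2 + 2 * (cmod (h x))\<^sup>2)"
        by simp
    qed
  qed simp
  then show ?thesis by (simp add: L2fun_def)
qed

lemma L2fun_linear:
  assumes g: "g \<in> L2fun M" and h: "h \<in> L2fun M"
  shows "(\<lambda>x. a * g x + b * h x) \<in> L2fun M"
proof -
  have scale: "(\<lambda>x. c * k x) \<in> L2fun M" if "k \<in> L2fun M" for c k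
    using that by (auto simp: L2fun_def norm_mult power_mult_distrib)
  from L2fun_diff[OF scale[OF g, of a] scale[OF h, of "- b"]] show ?thesis
    by simp
qed

lemma L2fun_mult_bounded:
  fixes h :: "real \<Rightarrow> real"
  assumes g: "g \<in> L2fun M" and [measurable]: "h \<in> borel_measurable M"
    and C: "AE x in M. \<bar>h x\<bar> \<le> C"
  shows "(\<lambda>x. complex_of_real (h x) * g x) \<in> L2fun M"
proof -
  have [measurable]: "g \<in> borel_measurable M" by (rule L2fun_measurable[OF g])
  have "integrable M (\<lambda>x. (cmod (complex_of_real (h x) * g x))\<^sup>2)"
  proof (rule Bochner_Integration.integrable_bound)
    show "integrable M (\<lambda>x. C\<^sup>2 * (cmod (g x))\<^sup>2)"
      using g by (auto simp: L2fun_def)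
    show "AE x in M. norm ((cmod (complex_of_real (h x) * g x))\<^sup>2) \<le> norm (C\<^sup>2 * (cmod (g x))\<^sup>2)"
      using C
    proof eventually_elim
      case (elim x)
      then have "\<bar>h x\<bar>\<^sup>2 \<le> C\<^sup>2" by (intro power_mono) auto
      then show ?case by (auto simp: norm_mult power_mult_distrib intro!: mult_right_mono)
    qed
  qed simp
  then show ?thesis by (simp add: L2fun_def)
qed

lemma P_sum_L2fun:
  assumes "finite A"
  shows "(\<lambda>x. \<Sum>p\<in>A. a p * complex_of_real (P p x)) \<in> L2fun M"
  using assms
proof (induction A)
  case empty
  then show ?case by (simp add: L2fun_def)
next
  case (insert p A)
  have "(\<lambda>x. complex_of_real (P p x)) \<in> L2fun M"
    using integrable_Re[OF P_P_integrable[of p p]] unfolding L2fun_def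
    by (simp add: power2_eq_square)
  from L2fun_linear[OF this insert.IH, of "a p" 1] insert.hyps show ?case
    by simp
qed

lemma coeff_diff:
  assumes "integrable M g" "integrable M h"
  shows "coeff (\<lambda>x. g x - h x) n = coeff g n - coeff h n"
  using integrable_mult_P[OF assms(1)] integrable_mult_P[OF assms(2)]
  by (simp add: coeff_def left_diff_distrib)

lemma coeff_linear:
  assumes "integrable M g" "integrable M h"
  shows "coeff (\<lambda>x. a * g x + b * h x) n = a * coeff g n + b * coeff h n"
  using integrable_mult_P[OF assms(1)] integrable_mult_P[OF assms(2)]
  by (simp add: coeff_def ring_distribs mult.assoc)

lemma coeff_P_sum:
  assumes "finite A"
  shows "coeff (\<lambda>x. \<Sum>p\<in>A. a p * complex_of_real (P p x)) n = (if n \<in> A then a n else 0)"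
proof -
  have "coeff (\<lambda>x. \<Sum>p\<in>A. a p * complex_of_real (P p x)) n
    = (LINT x|M. (\<Sum>p\<in>A. a p * (complex_of_real (P p x) * complex_of_real (P n x))))"
    by (simp add: coeff_def sum_distrib_right mult.assoc)
  also have "\<dots> = (\<Sum>p\<in>A. a p * (if p = n then 1 else 0))"
    by (subst Bochner_Integration.integral_sum) (auto simp: P_P_integrable orthonormal_complex)
  finally show ?thesis using assms by (simp add: if_distrib sum.delta' cong: if_cong)
qed

section \<open>Pythagoras and Bessel\<close>

lemma integral_cnj_P_sum:
  assumes "integrable M g" "finite A"
  shows "integrable M (\<lambda>x. g x * cnj (\<Sum>p\<in>A. a p * complex_of_real (P p x)))"
    and "(LINT x|M. g x * cnj (\<Sum>p\<in>A. a p * complex_of_real (P p x))) = (\<Sum>p\<in>A. cnj (a p) * coeff g p)"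
proof -
  have eq: "(\<lambda>x. g x * cnj (\<Sum>p\<in>A. a p * complex_of_real (P p x)))
    = (\<lambda>x. \<Sum>p\<in>A. cnj (a p) * (g x * complex_of_real (P p x)))"
    by (auto simp: sum_distrib_left mult_ac)
  show "integrable M (\<lambda>x. g x * cnj (\<Sum>p\<in>A. a p * complex_of_real (P p x)))"
    unfolding eq using integrable_mult_P[OF assms(1)] by auto
  show "(LINT x|M. g x * cnj (\<Sum>p\<in>A. a p * complex_of_real (P p x))) = (\<Sum>p\<in>A. cnj (a p) * coeff g p)"
    unfolding eq coeff_def using integrable_mult_P[OF assms(1)] by simp
qed

text \<open>Expand the square and integrate; the cross term is \<open>integral_cnj_P_sum\<close>.
  The coefficients \<open>a\<close> are left arbitrary because two special cases are needed:
  \<open>g = 0\<close> gives the norm of a finite sum, and \<open>a = coeff g\<close> gives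
  Pythagoras and hence Bessel's inequality.\<close>

lemma integral_square_diff_P_sum:
  assumes g: "g \<in> L2fun M" and A: "finite A"
  shows "(LINT x|M. (cmod (g x - (\<Sum>p\<in>A. a p * complex_of_real (P p x))))\<^sup>2)
    = (LINT x|M. (cmod (g x))\<^sup>2) - 2 * Re (\<Sum>p\<in>A. cnj (a p) * coeff g p) + (\<Sum>p\<in>A. (cmod (a p))\<^sup>2)"
proof -
  define S where "S = (\<lambda>x. \<Sum>p\<in>A. a p * complex_of_real (P p x))"
  have S: "S \<in> L2fun M" unfolding S_def by (rule P_sum_L2fun[OF A])
  have S_eq: "(\<Sum>p\<in>A. a p * complex_of_real (P p x)) = S x" for x by (simp add: S_def)
  note gS = integral_cnj_P_sum[OF L2fun_integrable[OF g] A, of a, unfolded S_eq]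
  note SS = integral_cnj_P_sum[OF L2fun_integrable[OF S] A, of a, unfolded S_eq]
  \<comment> \<open>This is the cross-term formula again, now with \<open>S\<close> in place of
    \<open>g\<close>: the coefficients of \<open>S\<close> on \<open>A\<close> are the
    \<open>a p\<close>.\<close>
  have "(LINT x|M. (cmod (S x))\<^sup>2) = Re (LINT x|M. S x * cnj (S x))"
    unfolding complex_norm_square[symmetric] integral_complex_of_real by simp
  also have "\<dots> = Re (\<Sum>p\<in>A. cnj (a p) * a p)"
    unfolding SS(2) by (rule arg_cong[where f=Re], rule sum.cong) (auto simp: S_def coeff_P_sum A)
  also have "\<dots> = (\<Sum>p\<in>A. (cmod (a p))\<^sup>2)"
    by (simp add: mult.commute[of "cnj _"] complex_norm_square[symmetric])
  finally have 1: "(LINT x|M. (cmod (S x))\<^sup>2) = (\<Sum>p\<in>A. (cmod (a p))\<^sup>2)" .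
  have 2: "(LINT x|M. Re (g x * cnj (S x))) = Re (\<Sum>p\<in>A. cnj (a p) * coeff g p)"
    unfolding gS(2)[symmetric] using gS(1) by (rule integral_Re)
  define T where "T = (\<lambda>x. Re (g x * cnj (S x)))"
  have T: "integrable M T" unfolding T_def by (rule integrable_Re[OF gS(1)])
  have "(LINT x|M. (cmod (g x - S x))\<^sup>2)
      = (LINT x|M. (cmod (g x))\<^sup>2 - 2 * T x + (cmod (S x))\<^sup>2)"
    by (intro Bochner_Integration.integral_cong refl)
      (unfold T_def cmod_power2, simp add: power2_eq_square algebra_simps)
  also have "\<dots> = (LINT x|M. (cmod (g x))\<^sup>2) - 2 * (LINT x|M. T x) + (LINT x|M. (cmod (S x))\<^sup>2)"
    using L2fun_integrable_square[OF g] L2fun_integrable_square[OF S] T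
    by simp
  finally show ?thesis unfolding 1 T_def 2 by (simp add: S_def)
qed

lemma integral_square_P_sum:
  assumes "finite A"
  shows "(LINT x|M. (cmod (\<Sum>p\<in>A. a p * complex_of_real (P p x)))\<^sup>2) = (\<Sum>p\<in>A. (cmod (a p))\<^sup>2)"
proof -
  have "(\<lambda>_. 0) \<in> L2fun M" by (simp add: L2fun_def)
  from integral_square_diff_P_sum[OF this assms, of a] show ?thesis
    by (simp add: coeff_def)
qed

lemma integral_square_diff_coeff_sum:
  assumes g: "g \<in> L2fun M" and A: "finite A"
  shows "(LINT x|M. (cmod (g x - (\<Sum>p\<in>A. coeff g p * complex_of_real (P p x))))\<^sup>2)
    = (LINT x|M. (cmod (g x))\<^sup>2) - (\<Sum>p\<in>A. (cmod (coeff g p))\<^sup>2)"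
  unfolding integral_square_diff_P_sum[OF assms]
  by (simp add: mult.commute[of "cnj _"] complex_norm_square[symmetric])

lemma bessel:
  assumes g: "g \<in> L2fun M" and A: "finite A"
  shows "(\<Sum>p\<in>A. (cmod (coeff g p))\<^sup>2) \<le> (LINT x|M. (cmod (g x))\<^sup>2)"
proof -
  have "0 \<le> (LINT x|M. (cmod (g x - (\<Sum>p\<in>A. coeff g p * complex_of_real (P p x))))\<^sup>2)"
    by simp
  then show ?thesis unfolding integral_square_diff_coeff_sum[OF assms] by simp
qed

lemma summable_coeff_square:
  assumes g: "g \<in> L2fun M"
  shows "summable (\<lambda>p. (cmod (coeff g p))\<^sup>2)"
  by (rule summableI_nonneg_bounded[where x = "LINT x|M. (cmod (g x))\<^sup>2"]) (auto intro: bessel[OF g])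

section \<open>Convergence of orthogonal series\<close>

lemma L1_le_L2:
  assumes "g \<in> L2fun M"
  shows "(LINT x|M. cmod (g x))\<^sup>2 \<le> (LINT x|M. (cmod (g x))\<^sup>2) * measure M (space M)"
proof -
  have [measurable]: "g \<in> borel_measurable M" by (rule L2fun_measurable[OF assms])
  have "(\<integral>\<^sup>+x. ennreal (cmod (g x)) * 1 \<partial>M)\<^sup>2 \<le> (\<integral>\<^sup>+x. ennreal (cmod (g x)) ^ 2 \<partial>M) * (\<integral>\<^sup>+x. 1 ^ 2 \<partial>M)"
    by (rule Cauchy_Schwarz_nn_integral) auto
  moreover have "(\<integral>\<^sup>+x. ennreal (cmod (g x)) \<partial>M) = ennreal (LINT x|M. cmod (g x))"
    using L2fun_integrable[OF assms] by (intro nn_integral_eq_integral) auto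
  moreover have "(\<integral>\<^sup>+x. ennreal (cmod (g x)) ^ 2 \<partial>M) = ennreal (LINT x|M. (cmod (g x))\<^sup>2)"
    using L2fun_integrable_square[OF assms]
    by (subst nn_integral_eq_integral[symmetric]) (auto simp: ennreal_power)
  ultimately show ?thesis
    by (simp add: ennreal_power emeasure_eq_measure flip: ennreal_mult)
qed

text \<open>By Pythagoras the partial sums are Cauchy in L2, hence in L1 by \<open>L1_le_L2\<close>,
  so a subsequence converges almost everywhere. Fatou's lemma carries the L2 tail bound over to the
  limit.\<close>

lemma L2_limit_exists:
  assumes a: "summable (\<lambda>p. (cmod (a p))\<^sup>2)"
  shows "\<exists>g\<in>L2fun M. \<forall>n. (LINT x|M. (cmod (g x - (\<Sum>p<n. a p * complex_of_real (P p x))))\<^sup>2)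
     \<le> (\<Sum>p. (cmod (a (p + n)))\<^sup>2)"
proof -
  define S where "S = (\<lambda>n x. \<Sum>p<n. a p * complex_of_real (P p x))"
  define R where "R = (\<lambda>n. \<Sum>p. (cmod (a (p + n)))\<^sup>2)"
  have S: "S n \<in> L2fun M" for n unfolding S_def by (rule P_sum_L2fun) simp
  have [measurable]: "S n \<in> borel_measurable M" for n by (rule L2fun_measurable[OF S])
  have R_nonneg: "0 \<le> R n" for n
    unfolding R_def using a by (intro suminf_nonneg summable_ignore_initial_segment) auto
  have R_tendsto: "R \<longlonglongrightarrow> 0"
    unfolding R_def by (rule suminf_exist_split2[OF a])
  have diff: "(LINT x|M. (cmod (S m x - S n x))\<^sup>2) \<le> R n" if "n \<le> m" for m n
  proof -
    have "S m x - S n x = (\<Sum>p\<in>{n..<m}. a p * complex_of_real (P p x))" for x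
      using that by (simp add: S_def lessThan_atLeast0 sum_diff_nat_ivl)
    then have "(LINT x|M. (cmod (S m x - S n x))\<^sup>2) = (\<Sum>p\<in>{n..<m}. (cmod (a p))\<^sup>2)"
      by (simp add: integral_square_P_sum)
    also have "\<dots> = (\<Sum>p<m-n. (cmod (a (p + n)))\<^sup>2)"
      using that sum.shift_bounds_nat_ivl[of "\<lambda>p. (cmod (a p))\<^sup>2" 0 n "m - n"]
      by (simp add: lessThan_atLeast0)
    also have "\<dots> \<le> R n"
      unfolding R_def by (intro sum_le_suminf summable_ignore_initial_segment[OF a]) auto
    finally show ?thesis .
  qed
  have L1: "(LINT x|M. norm (S m x - S n x)) \<le> sqrt (R n * measure M (space M))" if "n \<le> m" for m n
    using L1_le_L2[OF L2fun_diff[OF S S], of m n] diff[OF that]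
    by (intro real_le_rsqrt) (meson measure_nonneg mult_right_mono order_trans)
  have "\<exists>K. \<forall>i\<ge>K. \<forall>j\<ge>K. (LINT x|M. norm (S i x - S j x)) < e" if "e > 0" for e
  proof -
    have "(\<lambda>n. sqrt (R n * measure M (space M))) \<longlonglongrightarrow> sqrt (0 * measure M (space M))"
      by (intro tendsto_intros R_tendsto)
    then have "eventually (\<lambda>n. sqrt (R n * measure M (space M)) < e) sequentially"
      using that by (intro order_tendstoD(2)) auto
    then obtain K where K: "\<And>n. n \<ge> K \<Longrightarrow> sqrt (R n * measure M (space M)) < e"
      by (auto simp: eventually_sequentially)
    have "(LINT x|M. norm (S i x - S j x)) < e" if "i \<ge> K" "j \<ge> K" for i j
    proof (cases "j \<le> i")
      case True
      then show ?thesis using L1[OF True] K[OF that(2)] by simp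
    next
      case False
      then have "(LINT x|M. norm (S j x - S i x)) < e" using L1[of i j] K[OF that(1)] by simp
      then show ?thesis by (simp add: norm_minus_commute)
    qed
    then show ?thesis by blast
  qed
  then obtain r where r: "strict_mono r" "AE x in M. Cauchy (\<lambda>i. S (r i) x)"
    using cauchy_L1_AE_cauchy_subseq[of M S] L2fun_integrable[OF S] by blast
  define g where "g = (\<lambda>x. lim (\<lambda>i. S (r i) x))"
  have g_meas [measurable]: "g \<in> borel_measurable M"
    unfolding g_def by measurable
  have g_lim: "AE x in M. (\<lambda>i. S (r i) x) \<longlonglongrightarrow> g x"
    using r(2) by eventually_elim (simp add: g_def Cauchy_convergent_iff convergent_LIMSEQ_iff)
  \<comment> \<open>Fatou along the subsequence: for fixed \<open>n\<close>, all
    \<open>S (r i)\<close> with \<open>i >= n\<close> lie within squared distance \<open>R n\<close>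
    of \<open>S n\<close>, since \<open>r i >= i\<close>.\<close>
  have bound: "(\<integral>\<^sup>+x. ennreal ((cmod (g x - S n x))\<^sup>2) \<partial>M) \<le> ennreal (R n)" for n
  proof -
    have "(\<integral>\<^sup>+x. ennreal ((cmod (g x - S n x))\<^sup>2) \<partial>M)
      = (\<integral>\<^sup>+x. liminf (\<lambda>i. ennreal ((cmod (S (r i) x - S n x))\<^sup>2)) \<partial>M)"
    proof (rule nn_integral_cong_AE)
      show "AE x in M. ennreal ((cmod (g x - S n x))\<^sup>2)
          = liminf (\<lambda>i. ennreal ((cmod (S (r i) x - S n x))\<^sup>2))"
        using g_lim
      proof eventually_elim
        case (elim x)
        then have "(\<lambda>i. ennreal ((cmod (S (r i) x - S n x))\<^sup>2)) \<longlonglongrightarrow> ennreal ((cmod (g x - S n x))\<^sup>2)"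
          by (intro tendsto_ennrealI tendsto_intros)
        then show ?case using lim_imp_Liminf[OF sequentially_bot] by metis
      qed
    qed
    also have "\<dots> \<le> liminf (\<lambda>i. \<integral>\<^sup>+x. ennreal ((cmod (S (r i) x - S n x))\<^sup>2) \<partial>M)"
      by (rule nn_integral_liminf) measurable
    also have "\<dots> \<le> ennreal (R n)"
    proof -
      have "eventually (\<lambda>i. (\<integral>\<^sup>+x. ennreal ((cmod (S (r i) x - S n x))\<^sup>2) \<partial>M) \<le> ennreal (R n)) sequentially"
        using eventually_ge_at_top[of n]
      proof eventually_elim
        case (elim i)
        then have "n \<le> r i" using seq_suble[OF r(1), of i] by simp
        then show ?case
          using L2fun_integrable_square[OF L2fun_diff[OF S S], of "r i" n] diff[of n "r i"] R_nonneg
          by (subst nn_integral_eq_integral) auto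
      qed
      then show ?thesis by (intro Liminf_le) auto
    qed
    finally show ?thesis .
  qed
  have int: "integrable M (\<lambda>x. (cmod (g x - S n x))\<^sup>2)" for n
    by (rule integrableI_bounded) (use bound[of n] in \<open>auto simp: le_less_trans[OF _ ennreal_less_top]\<close>)
  \<comment> \<open>\<open>S 0\<close> is the zero function, so the case \<open>n = 0\<close> is
    square integrability of \<open>g\<close> itself.\<close>
  have "g \<in> L2fun M"
    using int[of 0] by (simp add: L2fun_def S_def)
  moreover have "(LINT x|M. (cmod (g x - S n x))\<^sup>2) \<le> R n" for n
    using bound[of n] int[of n] R_nonneg[of n] by (subst (asm) nn_integral_eq_integral) auto
  ultimately show ?thesis unfolding S_def R_def by blast
qed

theorem riesz_fischer:
  assumes a: "summable (\<lambda>p. (cmod (a p))\<^sup>2)"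
  shows "\<exists>g\<in>L2fun M. (\<forall>p. coeff g p = a p) \<and> (LINT x|M. (cmod (g x))\<^sup>2) = (\<Sum>p. (cmod (a p))\<^sup>2)"
proof -
  define S where "S = (\<lambda>n x. \<Sum>p<n. a p * complex_of_real (P p x))"
  define R where "R = (\<lambda>n. \<Sum>p. (cmod (a (p + n)))\<^sup>2)"
  have S: "S n \<in> L2fun M" for n unfolding S_def by (rule P_sum_L2fun) simp
  have R_tendsto: "R \<longlonglongrightarrow> 0"
    unfolding R_def by (rule suminf_exist_split2[OF a])
  obtain g where g: "g \<in> L2fun M" and gR: "\<And>n. (LINT x|M. (cmod (g x - S n x))\<^sup>2) \<le> R n"
    using L2_limit_exists[OF a] unfolding S_def R_def by blast
  have coeff: "coeff g p = a p" for p
  proof -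
    \<comment> \<open>Once \<open>n > p\<close>, \<open>S n\<close> has \<open>p\<close>-th
      coefficient \<open>a p\<close>. Bessel for the single index \<open>p\<close>, applied to
      \<open>g - S n\<close>, then bounds the discrepancy by a tail that tends to 0.\<close>
    have "(cmod (coeff g p - a p))\<^sup>2 \<le> R n" if "n > p" for n
    proof -
      have "coeff (\<lambda>x. g x - S n x) p = coeff g p - a p"
        using that unfolding coeff_diff[OF L2fun_integrable[OF g] L2fun_integrable[OF S]]
        by (simp add: S_def coeff_P_sum)
      then show ?thesis
        using bessel[OF L2fun_diff[OF g S], of "{p}" n] gR[of n] by simp
    qed
    then have "(cmod (coeff g p - a p))\<^sup>2 \<le> 0"
      by (intro LIMSEQ_le_const[OF R_tendsto]) (auto intro!: exI[of _ "Suc p"])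
    then show ?thesis by simp
  qed
  have "(\<lambda>n. \<Sum>p<n. (cmod (a p))\<^sup>2) \<longlonglongrightarrow> (LINT x|M. (cmod (g x))\<^sup>2)"
  proof (rule tendsto_sandwich)
    have eq: "(LINT x|M. (cmod (g x - S n x))\<^sup>2) = (LINT x|M. (cmod (g x))\<^sup>2) - (\<Sum>p<n. (cmod (a p))\<^sup>2)" for n
      using integral_square_diff_coeff_sum[OF g, of "{..<n}"] by (simp add: coeff S_def)
    show "eventually (\<lambda>n. (LINT x|M. (cmod (g x))\<^sup>2) - R n \<le> (\<Sum>p<n. (cmod (a p))\<^sup>2)) sequentially"
      using gR unfolding eq by (intro always_eventually) (auto simp: algebra_simps)
    show "eventually (\<lambda>n. (\<Sum>p<n. (cmod (a p))\<^sup>2) \<le> (LINT x|M. (cmod (g x))\<^sup>2)) sequentially"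
      using bessel[OF g] by (intro always_eventually) (auto simp: coeff)
    show "(\<lambda>n. (LINT x|M. (cmod (g x))\<^sup>2) - R n) \<longlonglongrightarrow> (LINT x|M. (cmod (g x))\<^sup>2)"
      using tendsto_diff[OF tendsto_const R_tendsto] by simp
  qed simp
  then have "(LINT x|M. (cmod (g x))\<^sup>2) = (\<Sum>p. (cmod (a p))\<^sup>2)"
    using LIMSEQ_unique summable_LIMSEQ[OF a] by blast
  with g coeff show ?thesis by blast
qed

end

section \<open>Orthonormality of the Bernstein--Szego polynomials\<close>

text \<open>The prefix \<open>bs\<close> stands for Bernstein--Szego.\<close>

fun bs_poly :: "real \<Rightarrow> nat \<Rightarrow> real \<Rightarrow> real" where
  "bs_poly q 0 x = 1"
| "bs_poly q (Suc 0) x = 2 * x - q"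
| "bs_poly q (Suc (Suc n)) x = 2 * x * bs_poly q (Suc n) x - bs_poly q n x"

text \<open>At \<open>x = cos t\<close> the denominator is the squared modulus of
  \<open>1 - q * exp (i t)\<close>. For \<open>q = 1\<close> it vanishes at \<open>x = 1\<close>,
  where division by zero gives the value 0.\<close>

definition bs_weight :: "real \<Rightarrow> real \<Rightarrow> real" where
  "bs_weight q x = indicator {-1..1} x * ((2 / pi) * sqrt (1 - x\<^sup>2) / (1 - 2 * q * x + q\<^sup>2))"

definition bs_measure :: "real \<Rightarrow> real measure" where
  "bs_measure q = density lborel (bs_weight q)"

section \<open>Trigonometric form of the polynomials\<close>

lemma continuous_on_bs_poly [continuous_intros]: "continuous_on A (bs_poly q n)"
\<comment> \<open>The recursion also takes the evaluation point as an argument, so the induction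
  rule asks for one; 0 is a placeholder.\<close>
proof (induction q n "0::real" rule: bs_poly.induct)
qed (auto intro!: continuous_intros)

lemma sin_three_term: "sin ((r + 2) * t) = 2 * cos t * sin ((r + 1) * t) - sin (r * t)" for r t :: real
proof -
  have "sin ((r + 1) * t + t) + sin ((r + 1) * t - t) = 2 * cos t * sin ((r + 1) * t)"
    unfolding sin_add sin_diff by simp
  then show ?thesis by (simp add: algebra_simps)
qed

text \<open>Since \<open>sin t * U_n (cos t) = sin ((n + 1) * t)\<close>, this is
  \<open>P_n = U_n - q * U_{n-1}\<close> multiplied by \<open>sin t\<close>. Both sides obey the
  same three-term recurrence, and \<open>sin 0 = 0\<close> supplies the convention
  \<open>U_{-1} = 0\<close>.\<close>

lemma sin_mult_bs_poly_cos:
  "sin t * bs_poly q n (cos t) = sin ((real n + 1) * t) - q * sin (real n * t)"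
proof (induction n rule: induct_nat_012)
  case 0
  then show ?case by simp
next
  case 1
  then show ?case using sin_double[of t] by (simp add: algebra_simps)
next
  case (ge2 n)
  have "sin t * bs_poly q (Suc (Suc n)) (cos t)
    = 2 * cos t * (sin t * bs_poly q (Suc n) (cos t)) - sin t * bs_poly q n (cos t)"
    by (simp add: algebra_simps)
  moreover have "sin ((real (Suc (Suc n)) + 1) * t)
    = 2 * cos t * sin ((real (Suc n) + 1) * t) - sin ((real n + 1) * t)"
    using sin_three_term[of "real n + 1" t] by (simp add: add_ac)
  moreover have "sin (real (Suc (Suc n)) * t) = 2 * cos t * sin (real (Suc n) * t) - sin (real n * t)"
    using sin_three_term[of "real n" t] by (simp add: add_ac)
  ultimately show ?case
    unfolding ge2 by (simp only: right_diff_distrib) (simp only: mult_ac diff_diff_eq2 diff_diff_eq add_ac)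
qed

text \<open>With \<open>2 * x * U_n = U_{n+1} + U_{n-1}\<close>, the combination
  \<open>P_n - q * P_{n+1}\<close> equals \<open>(1 - 2 * q * x + q^2) * U_n\<close>. The factor
  cancels the denominator of the weight, leaving an elementary integrand.\<close>

lemma bs_poly_diff_eq_sin:
  assumes "x \<in> {-1..1}"
  shows "sqrt (1 - x\<^sup>2) * (bs_poly q n x - q * bs_poly q (Suc n) x)
    = (1 - 2 * q * x + q\<^sup>2) * sin ((real n + 1) * arccos x)"
proof -
  define t where "t = arccos x"
  have x: "x = cos t" "sqrt (1 - x\<^sup>2) = sin t"
    using assms by (auto simp: t_def sin_arccos)
  have 1: "sin ((real (Suc n) + 1) * t) = 2 * cos t * sin ((real n + 1) * t) - sin (real n * t)"
    using sin_three_term[of "real n" t] by (simp add: add_ac)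
  have 2: "sin (real (Suc n) * t) = sin ((real n + 1) * t)"
    by (simp add: add_ac)
  have "sin t * (bs_poly q n (cos t) - q * bs_poly q (Suc n) (cos t))
    = (1 - 2 * q * cos t + q\<^sup>2) * sin ((real n + 1) * t)"
    unfolding right_diff_distrib mult.left_commute[of "sin t" q] sin_mult_bs_poly_cos 1 2
    by (simp add: algebra_simps power2_eq_square)
  then show ?thesis unfolding t_def[symmetric] using x by simp
qed

lemma has_integral_sin_arccos:
  "((\<lambda>x. sin ((real n + 1) * arccos x)) has_integral (if n = 0 then pi / 2 else 0)) {-1..1}"
proof -
  \<comment> \<open>Substituting \<open>x = cos t\<close> turns the integrand into \<open>- sin ((n
    + 1) * t) * sin t = - (cos (n * t) - cos ((n + 2) * t)) / 2\<close>, and \<open>F\<close> is its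
    primitive. For \<open>n = 0\<close> the term \<open>sin (n * t) / n\<close> becomes
    \<open>t\<close>. The fundamental theorem is used in its interior form because
    \<open>arccos\<close> is not differentiable at the endpoints.\<close>
  define F :: "real \<Rightarrow> real" where "F = (\<lambda>x. - ((if n = 0 then arccos x else sin (real n * arccos x) / real n)
     - sin ((real n + 2) * arccos x) / (real n + 2)) / 2)"
  have "((\<lambda>x. sin ((real n + 1) * arccos x)) has_integral (F 1 - F (-1))) {-1..1}"
  proof (rule fundamental_theorem_of_calculus_interior)
    show "continuous_on {-1..1} F"
      unfolding F_def by (cases "n = 0") (auto intro!: continuous_intros)
    fix x :: real assume x: "x \<in> {-1<..<1}"
    define t where "t = arccos x"
    have t: "sin t = sqrt (1 - x\<^sup>2)" "sqrt (1 - x\<^sup>2) > 0"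
      using x by (auto simp: t_def sin_arccos abs_square_less_1 abs_less_iff)
    have "(F has_real_derivative
       - ((cos (real n * t) - cos ((real n + 2) * t)) * inverse (- sqrt (1 - x\<^sup>2))) / 2) (at x)"
    proof -
      let ?k = "inverse (- sqrt (1 - x\<^sup>2))"
      have arccos: "(arccos has_real_derivative ?k) (at x)"
        using x by (intro DERIV_arccos) auto
      have sin: "((\<lambda>x. sin (c * arccos x) / c) has_real_derivative cos (c * t) * ?k) (at x)"
        if "c \<noteq> 0" for c
        using that x by (auto intro!: derivative_eq_intros arccos simp: t_def)
      have "((\<lambda>x. if n = 0 then arccos x else sin (real n * arccos x) / real n)
          has_real_derivative cos (real n * t) * ?k) (at x)"
        using arccos sin[of "real n"] by (cases "n = 0") auto
      from DERIV_cdivide[OF DERIV_minus[OF DERIV_diff[OF this sin[of "real n + 2"]]], of 2]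
      show ?thesis unfolding F_def by (simp add: left_diff_distrib)
    qed
    moreover have "cos (real n * t) - cos ((real n + 2) * t) = 2 * sin ((real n + 1) * t) * sin t"
      using cos_diff[of "(real n + 1) * t" t] cos_add[of "(real n + 1) * t" t]
      by (simp add: algebra_simps)
    ultimately show "(F has_vector_derivative sin ((real n + 1) * arccos x)) (at x)"
      using t by (simp add: has_real_derivative_iff_has_vector_derivative t_def)
  qed simp
  moreover have "F 1 - F (-1) = (if n = 0 then pi / 2 else 0)"
  proof -
    have "sin ((real n + 2) * pi) = 0"
      using sin_npi[of "n + 2"] by (simp add: add.commute)
    then show ?thesis by (simp add: F_def)
  qed
  ultimately show ?thesis by simp
qed

section \<open>Total mass of the density\<close>

context
  fixes q :: real
  assumes q: "0 < q" "q \<le> 1"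
begin

lemma bs_denom_pos: "x < 1 \<Longrightarrow> 0 < 1 - 2 * q * x + q\<^sup>2"
proof -
  assume "x < 1"
  then have "0 < 2 * q * (1 - x)" using q by simp
  moreover have "1 - 2 * q * x + q\<^sup>2 = (1 - q)\<^sup>2 + 2 * q * (1 - x)"
    by (simp add: power2_eq_square algebra_simps)
  ultimately show ?thesis by (simp add: add_nonneg_pos)
qed

text \<open>An explicit primitive is differentiated in the open interval. The case
  \<open>q = 1\<close> is separate because the denominator then vanishes at \<open>x = 1\<close>, so
  the primitive for \<open>q < 1\<close> breaks down there.\<close>

lemma has_integral_bs_density:
  "((\<lambda>x. sqrt (1 - x\<^sup>2) / (1 - 2 * q * x + q\<^sup>2)) has_integral (pi / 2)) {-1..1}"
proof (cases "q = 1")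
  case True
  \<comment> \<open>For \<open>q = 1\<close>, with \<open>s = sqrt (1 - x^2)\<close>, the integrand
    is \<open>(1 + x) / (2 * s)\<close>.\<close>
  define F :: "real \<Rightarrow> real" where "F = (\<lambda>x. (arcsin x - sqrt (1 - x\<^sup>2)) / 2)"
  have "((\<lambda>x. sqrt (1 - x\<^sup>2) / (1 - 2 * q * x + q\<^sup>2)) has_integral (F 1 - F (-1))) {-1..1}"
  proof (rule fundamental_theorem_of_calculus_interior)
    show "continuous_on {-1..1} F"
      unfolding F_def by (auto intro!: continuous_intros)
    fix x :: real assume x: "x \<in> {-1<..<1}"
    define s where "s = sqrt (1 - x\<^sup>2)"
    have lt: "0 < 1 - x\<^sup>2" using x by (simp add: abs_square_less_1 abs_less_iff)
    then have s: "s > 0" "s\<^sup>2 = 1 - x\<^sup>2" by (auto simp: s_def)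
    have "(F has_real_derivative (inverse s - (- 2 * x) * inverse s / 2) / 2) (at x)"
      unfolding F_def s_def using x lt
      by (auto intro!: derivative_eq_intros simp: field_simps)
    moreover have "(inverse s - (- 2 * x) * inverse s / 2) / 2 = s / (1 - 2 * q * x + q\<^sup>2)"
      using s x True by (simp add: field_simps power2_eq_square)
    ultimately show "(F has_vector_derivative sqrt (1 - x\<^sup>2) / (1 - 2 * q * x + q\<^sup>2)) (at x)"
      unfolding has_real_derivative_iff_has_vector_derivative[symmetric] s_def[symmetric]
      by (rule DERIV_cong)
  qed simp
  then show ?thesis by (simp add: F_def)
next
  case False
  with q have q1: "q < 1" by simp
  define D where "D = (\<lambda>x. 1 - 2 * q * x + q\<^sup>2)"
  \<comment> \<open>\<open>y\<close> is the Moebius automorphism of \<open>[-1,1]\<close> under which \<open>(1 - q\<^sup>2) dx / (D s)\<close>, with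
    \<open>s = sqrt (1 - x\<^sup>2)\<close>, becomes \<open>d (arcsin y)\<close>; then use
    \<open>4 q\<^sup>2 s\<^sup>2 = 2 (1 + q\<^sup>2) D - D\<^sup>2 - (1 - q\<^sup>2)\<^sup>2\<close>.\<close>
  define y where "y = (\<lambda>x. ((1 + q\<^sup>2) * x - 2 * q) / D x)"
  define F :: "real \<Rightarrow> real" where
    "F = (\<lambda>x. ((1 + q\<^sup>2) * arcsin x - (1 - q\<^sup>2) * arcsin (y x) - 2 * q * sqrt (1 - x\<^sup>2)) / (4 * q\<^sup>2))"
  have q2: "q\<^sup>2 < 1" using q q1 by (simp add: power_less_one_iff abs_square_less_1)
  have Dpos: "D x > 0" if "x \<le> 1" for x
  proof -
    have "D x = (1 - q)\<^sup>2 + 2 * q * (1 - x)"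
      by (simp add: D_def power2_eq_square algebra_simps)
    moreover have "0 \<le> 2 * q * (1 - x)" "0 < (1 - q)\<^sup>2" using q q1 that by auto
    ultimately show ?thesis by linarith
  qed
  \<comment> \<open>Used twice: it shows that \<open>y\<close> maps into \<open>[-1,1]\<close>,
    where \<open>arcsin\<close> is continuous, and it evaluates the square root in the derivative of
    \<open>arcsin (y x)\<close>.\<close>
  have y_sq: "1 - (y x)\<^sup>2 = (1 - q\<^sup>2)\<^sup>2 * (1 - x\<^sup>2) / (D x)\<^sup>2" if "x \<le> 1" for x
  proof -
    have "(D x)\<^sup>2 - ((1 + q\<^sup>2) * x - 2 * q)\<^sup>2 = (1 - q\<^sup>2)\<^sup>2 * (1 - x\<^sup>2)"
      unfolding D_def by algebra
    then show ?thesis using Dpos[OF that] by (simp add: y_def power_divide field_simps)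
  qed
  have y_range: "-1 \<le> y x \<and> y x \<le> 1" if "x \<in> {-1..1}" for x
  proof -
    have "0 \<le> 1 - (y x)\<^sup>2"
      using that unfolding y_sq[of x, simplified] by (subst y_sq) (auto simp: abs_square_le_1 abs_le_iff)
    then show ?thesis by (simp add: abs_square_le_1 abs_le_iff)
  qed
  have "((\<lambda>x. sqrt (1 - x\<^sup>2) / D x) has_integral (F 1 - F (-1))) {-1..1}"
  proof (rule fundamental_theorem_of_calculus_interior)
    have "continuous_on {-1..1} y"
      unfolding y_def using Dpos by (force simp: D_def intro!: continuous_intros)
    then show "continuous_on {-1..1} F"
      unfolding F_def using y_range by (intro continuous_intros) (use q in auto)
    fix x :: real assume x: "x \<in> {-1<..<1}"
    define s where "s = sqrt (1 - x\<^sup>2)"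
    have lt: "0 < 1 - x\<^sup>2" using x by (simp add: abs_square_less_1 abs_less_iff)
    then have s: "s > 0" "s\<^sup>2 = 1 - x\<^sup>2" by (auto simp: s_def)
    have D: "D x > 0" using x by (intro Dpos) auto
    have ysq: "1 - (y x)\<^sup>2 = ((1 - q\<^sup>2) * s / D x)\<^sup>2"
      using y_sq[of x] x s by (simp add: power_mult_distrib power_divide)
    have sy: "sqrt (1 - (y x)\<^sup>2) = (1 - q\<^sup>2) * s / D x"
      unfolding ysq using q2 s D by simp
    have "0 < 1 - (y x)\<^sup>2" unfolding ysq using q2 s D by simp
    then have yx: "-1 < y x" "y x < 1" by (auto simp: abs_square_less_1 abs_less_iff)
    have dy: "(y has_real_derivative (1 - q\<^sup>2)\<^sup>2 / (D x)\<^sup>2) (at x)"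
    proof -
      have "(y has_real_derivative ((1 + q\<^sup>2) * D x - ((1 + q\<^sup>2) * x - 2 * q) * (- 2 * q)) / (D x * D x)) (at x)"
        unfolding y_def using D unfolding D_def
        by (auto intro!: derivative_eq_intros)
      moreover have "(1 + q\<^sup>2) * D x - ((1 + q\<^sup>2) * x - 2 * q) * (- 2 * q) = (1 - q\<^sup>2)\<^sup>2"
        unfolding D_def by algebra
      ultimately show ?thesis by (simp add: power2_eq_square)
    qed
    have "((\<lambda>x. arcsin (y x)) has_real_derivative inverse (sqrt (1 - (y x)\<^sup>2)) * ((1 - q\<^sup>2)\<^sup>2 / (D x)\<^sup>2)) (at x)"
      by (rule DERIV_chain2[OF DERIV_arcsin dy]) (use yx in auto)
    moreover have "inverse (sqrt (1 - (y x)\<^sup>2)) * ((1 - q\<^sup>2)\<^sup>2 / (D x)\<^sup>2) = (1 - q\<^sup>2) / (s * D x)"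
      unfolding sy using s D q2 by (simp add: field_simps power2_eq_square)
    ultimately have darc: "((\<lambda>x. arcsin (y x)) has_real_derivative (1 - q\<^sup>2) / (s * D x)) (at x)"
      by simp
    have dsqrt: "((\<lambda>x. sqrt (1 - x\<^sup>2)) has_real_derivative - x * inverse s) (at x)"
      using lt by (auto intro!: derivative_eq_intros simp: s_def field_simps)
    have darcsin: "(arcsin has_real_derivative inverse s) (at x)"
      unfolding s_def using x by (intro DERIV_arcsin) auto
    have "(F has_real_derivative
       ((1 + q\<^sup>2) * inverse s - (1 - q\<^sup>2) * ((1 - q\<^sup>2) / (s * D x)) - 2 * q * (- x * inverse s)) / (4 * q\<^sup>2)) (at x)"
      unfolding F_def by (intro DERIV_cdivide DERIV_diff DERIV_cmult darc dsqrt darcsin)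
    moreover have "((1 + q\<^sup>2) * inverse s - (1 - q\<^sup>2) * ((1 - q\<^sup>2) / (s * D x)) - 2 * q * (- x * inverse s)) / (4 * q\<^sup>2)
       = s / D x"
    proof -
      have "(1 + q\<^sup>2) * D x - (1 - q\<^sup>2) * (1 - q\<^sup>2) + 2 * q * x * D x = 4 * q\<^sup>2 * s\<^sup>2"
        unfolding s D_def by algebra
      moreover have "(1 + q\<^sup>2) * inverse s - (1 - q\<^sup>2) * ((1 - q\<^sup>2) / (s * D x)) - 2 * q * (- x * inverse s)
          = ((1 + q\<^sup>2) * D x - (1 - q\<^sup>2) * (1 - q\<^sup>2) + 2 * q * x * D x) / (s * D x)"
        using s(1) D by (simp add: field_simps)
      ultimately show ?thesis using s(1) D q by (simp add: power2_eq_square)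
    qed
    ultimately show "(F has_vector_derivative sqrt (1 - x\<^sup>2) / D x) (at x)"
      unfolding has_real_derivative_iff_has_vector_derivative[symmetric] s_def[symmetric]
      by (rule DERIV_cong)
  qed simp
  \<comment> \<open>\<open>y\<close> fixes both endpoints, so the difference is
    \<open>((1 + q^2) - (1 - q^2)) * pi / (4 * q^2)\<close>.\<close>
  moreover have "F 1 - F (-1) = pi / 2"
  proof -
    have "D 1 = 1 + q\<^sup>2 - 2 * q" "D (-1) = 1 + q\<^sup>2 + 2 * q" by (auto simp: D_def)
    then have "y 1 = 1" "y (-1) = -1"
      using Dpos[of 1] Dpos[of "-1"] by (auto simp: y_def field_simps)
    then show ?thesis using q by (simp add: F_def field_simps)
  qed
  ultimately show ?thesis by (simp add: D_def)
qed

section \<open>The weight as a probability measure on \<open>[-1,1]\<close>\<close>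

lemma bs_weight_measurable [measurable]: "bs_weight q \<in> borel_measurable borel"
  unfolding bs_weight_def by measurable

lemma bs_weight_nonneg: "0 \<le> bs_weight q x"
proof (cases "x < 1")
  case True
  then show ?thesis using bs_denom_pos[OF True]
    by (auto simp: bs_weight_def indicator_def abs_square_le_1 abs_le_iff)
next
  case False
  then show ?thesis by (cases "x = 1") (auto simp: bs_weight_def)
qed

lemma sets_bs_measure [simp, measurable_cong]: "sets (bs_measure q) = sets borel"
  by (simp add: bs_measure_def)

lemma space_bs_measure [simp]: "space (bs_measure q) = UNIV"
  by (simp add: bs_measure_def)

lemma integral_bs_measure:
  fixes h :: "real \<Rightarrow> real"
  assumes [measurable]: "h \<in> borel_measurable borel"
  shows "(LINT x|bs_measure q. h x) = (LINT x|lborel. bs_weight q x * h x)"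
  unfolding bs_measure_def by (subst integral_density) (auto simp: bs_weight_nonneg)

lemma integrable_bs_measure_iff:
  fixes h :: "real \<Rightarrow> real"
  assumes [measurable]: "h \<in> borel_measurable borel"
  shows "integrable (bs_measure q) h \<longleftrightarrow> integrable lborel (\<lambda>x. bs_weight q x * h x)"
  unfolding bs_measure_def by (subst integrable_density) (auto simp: bs_weight_nonneg)

lemma emeasure_bs_measure: "emeasure (bs_measure q) UNIV = 1"
proof -
  have "((\<lambda>x. (2 / pi) * (sqrt (1 - x\<^sup>2) / (1 - 2 * q * x + q\<^sup>2))) has_integral (2 / pi) * (pi / 2)) {-1..1}"
    by (rule has_integral_mult_right[OF has_integral_bs_density])
  then have "((\<lambda>x. if x \<in> {-1..1} then (2 / pi) * (sqrt (1 - x\<^sup>2) / (1 - 2 * q * x + q\<^sup>2)) else 0) has_integral 1) UNIV"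
    unfolding has_integral_restrict_UNIV by simp
  then have "(bs_weight q has_integral 1) UNIV"
    by (rule has_integral_eq[rotated]) (auto simp: bs_weight_def)
  then have "integral\<^sup>N lborel (bs_weight q) = ennreal 1"
    by (intro nn_integral_has_integral_lborel) (auto simp: bs_weight_nonneg)
  then show ?thesis
    by (simp add: bs_measure_def emeasure_density)
qed

lemma finite_measure_bs_measure: "finite_measure (bs_measure q)"
  by (rule finite_measureI) (simp add: emeasure_bs_measure)

lemma AE_bs_measure: "AE x in bs_measure q. x \<in> {-1..1}"
  unfolding bs_measure_def by (subst AE_density) (auto simp: bs_weight_def indicator_def)

lemma continuous_AE_bounded:
  fixes h :: "real \<Rightarrow> real"
  assumes "continuous_on UNIV h"
  shows "\<exists>C. AE x in bs_measure q. \<bar>h x\<bar> \<le> C"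
proof -
  have "bounded (h ` {-1..1})"
    by (intro compact_imp_bounded compact_continuous_image continuous_on_subset[OF assms]) auto
  then obtain C where C: "\<And>x. x \<in> {-1..1} \<Longrightarrow> \<bar>h x\<bar> \<le> C"
    unfolding bounded_iff by (metis imageI real_norm_def)
  have "AE x in bs_measure q. \<bar>h x\<bar> \<le> C"
    using AE_bs_measure by eventually_elim (rule C)
  then show ?thesis by blast
qed

lemma continuous_integrable:
  fixes h :: "real \<Rightarrow> real"
  assumes "continuous_on UNIV h"
  shows "integrable (bs_measure q) h"
proof -
  interpret finite_measure "bs_measure q" by (rule finite_measure_bs_measure)
  obtain C where "AE x in bs_measure q. \<bar>h x\<bar> \<le> C" using continuous_AE_bounded[OF assms] by blast
  then show ?thesis
    using borel_measurable_continuous_onI[OF assms]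
    by (intro integrable_const_bound[where B=C]) auto
qed

section \<open>Orthonormality\<close>

lemma integral_bs_poly_diff:
  "(LINT x|bs_measure q. bs_poly q n x - q * bs_poly q (Suc n) x) = (if n = 0 then 1 else 0)"
proof -
  let ?h = "\<lambda>x. bs_poly q n x - q * bs_poly q (Suc n) x"
  have cont: "continuous_on UNIV ?h" by (intro continuous_intros)
  have meas [measurable]: "?h \<in> borel_measurable borel" by (rule borel_measurable_continuous_onI[OF cont])
  have 1: "((\<lambda>x. bs_weight q x * ?h x) has_integral (LINT x|bs_measure q. ?h x)) UNIV"
    unfolding integral_bs_measure[OF meas]
    using continuous_integrable[OF cont] unfolding integrable_bs_measure_iff[OF meas]
    by (rule has_integral_integral_lborel)
  have "((\<lambda>x. (2 / pi) * sin ((real n + 1) * arccos x)) has_integral (2 / pi) * (if n = 0 then pi / 2 else 0)) {-1..1}"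
    by (rule has_integral_mult_right[OF has_integral_sin_arccos])
  then have "((\<lambda>x. if x \<in> {-1..1} then (2 / pi) * sin ((real n + 1) * arccos x) else 0) has_integral (if n = 0 then 1 else 0)) UNIV"
    unfolding has_integral_restrict_UNIV by (simp split: if_splits)
  \<comment> \<open>The denominator can be cancelled only where it is nonzero. The point
    \<open>x = 1\<close> is dropped as a null set, since for \<open>q = 1\<close> the denominator
    vanishes there.\<close>
  then have "((\<lambda>x. bs_weight q x * ?h x) has_integral (if n = 0 then 1 else 0)) UNIV"
  proof (rule has_integral_spike_finite[rotated 2])
    fix x :: real assume x: "x \<in> UNIV - {1}"
    show "bs_weight q x * ?h x = (if x \<in> {-1..1} then (2 / pi) * sin ((real n + 1) * arccos x) else 0)"
    proof (cases "x \<in> {-1..1}")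
      case True
      with x have "x < 1" by auto
      with bs_poly_diff_eq_sin[OF True, of q n] bs_denom_pos[of x] True show ?thesis
        by (simp add: bs_weight_def divide_simps)
    qed (auto simp: bs_weight_def)
  qed simp
  with 1 show ?thesis by (rule has_integral_unique)
qed

text \<open>\<open>integral_bs_poly_diff\<close> is a first-order recursion for these integrals. The
  total mass starts it, and \<open>q > 0\<close> allows solving for the next integral.\<close>

lemma integral_bs_poly: "(LINT x|bs_measure q. bs_poly q n x) = (if n = 0 then 1 else 0)"
proof (induction n)
  case 0
  then show ?case using emeasure_bs_measure by (simp add: measure_def)
next
  case (Suc n)
  have int: "integrable (bs_measure q) (bs_poly q m)" for m
    by (rule continuous_integrable) (rule continuous_on_bs_poly)
  have "(LINT x|bs_measure q. bs_poly q n x) - q * (LINT x|bs_measure q. bs_poly q (Suc n) x)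
      = (if n = 0 then 1 else 0)"
    using integral_bs_poly_diff[of n] int[of n] int[of "Suc n"] by simp
  then show ?case using q by (simp add: Suc)
qed

text \<open>Multiplication by \<open>2 * x\<close> can be moved from one factor to the other.
  Expanding \<open>P_{n+2}\<close> by its recurrence and absorbing \<open>2 * x\<close> into
  \<open>P_m\<close> leaves products with \<open>P_{n+1}\<close> and \<open>P_n\<close> only, known
  by induction for every first index. The cases of index 0 and 1 reduce to
  \<open>integral_bs_poly\<close>.\<close>

lemma bs_poly_orthonormal:
  "(LINT x|bs_measure q. bs_poly q m x * bs_poly q n x) = (if m = n then 1 else 0)"
proof (induction n arbitrary: m rule: induct_nat_012)
  case 0
  then show ?case by (simp add: integral_bs_poly)
next
  have int [simp]: "integrable (bs_measure q) (bs_poly q m)" for m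
    by (rule continuous_integrable) (rule continuous_on_bs_poly)
  case 1
  show ?case
  proof (cases m)
    case 0
    then show ?thesis using integral_bs_poly[of 1] by simp
  next
    case (Suc k)
    have "bs_poly q m x * bs_poly q (Suc 0) x
       = bs_poly q (Suc (Suc k)) x + bs_poly q k x - q * bs_poly q (Suc k) x" for x
      by (simp add: Suc algebra_simps)
    then have "(LINT x|bs_measure q. bs_poly q m x * bs_poly q (Suc 0) x)
       = (LINT x|bs_measure q. bs_poly q (Suc (Suc k)) x) + (LINT x|bs_measure q. bs_poly q k x)
         - q * (LINT x|bs_measure q. bs_poly q (Suc k) x)"
      by (simp del: bs_poly.simps)
    then show ?thesis by (simp add: integral_bs_poly Suc del: bs_poly.simps)
  qed
next
  have int [simp]: "integrable (bs_measure q) (\<lambda>x. bs_poly q m x * bs_poly q n x)" for m n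
    by (rule continuous_integrable) (intro continuous_intros)
  case (ge2 n)
  show ?case
  proof (cases m)
    case 0
    then show ?thesis using integral_bs_poly[of "Suc (Suc n)"] by simp
  next
    case (Suc k)
    have "bs_poly q m x * bs_poly q (Suc (Suc n)) x
       = bs_poly q (Suc (Suc k)) x * bs_poly q (Suc n) x + bs_poly q k x * bs_poly q (Suc n) x
         - bs_poly q (Suc k) x * bs_poly q n x" for x
      by (simp add: Suc algebra_simps)
    then have "(LINT x|bs_measure q. bs_poly q m x * bs_poly q (Suc (Suc n)) x)
       = (LINT x|bs_measure q. bs_poly q (Suc (Suc k)) x * bs_poly q (Suc n) x)
       + (LINT x|bs_measure q. bs_poly q k x * bs_poly q (Suc n) x)
       - (LINT x|bs_measure q. bs_poly q (Suc k) x * bs_poly q n x)"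
      by (simp del: bs_poly.simps)
    then show ?thesis by (simp add: ge2 Suc del: bs_poly.simps)
  qed
qed

lemma orthonormal_system_bs: "orthonormal_system (bs_measure q) (bs_poly q)"
proof -
  interpret finite_measure "bs_measure q" by (rule finite_measure_bs_measure)
  show ?thesis
  proof
    show "bs_poly q n \<in> borel_measurable (bs_measure q)" for n
      using borel_measurable_continuous_onI[OF continuous_on_bs_poly] by simp
    show "\<exists>C. AE x in bs_measure q. \<bar>bs_poly q n x\<bar> \<le> C" for n
      by (rule continuous_AE_bounded) (rule continuous_on_bs_poly)
  qed (rule bs_poly_orthonormal)
qed

end

section \<open>Completeness of the Bernstein--Szego polynomials\<close>

context
  fixes q :: real
  assumes q: "0 < q" "q \<le> 1"
begin

interpretation bs: orthonormal_system "bs_measure q" "bs_poly q"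
  by (rule orthonormal_system_bs[OF q])

section \<open>Multiplication by \<open>x\<close> on coefficients\<close>

lemma integrable_mult_continuous:
  fixes h :: "real \<Rightarrow> real" and g :: "real \<Rightarrow> complex"
  assumes g: "integrable (bs_measure q) g" and h: "continuous_on UNIV h"
  shows "integrable (bs_measure q) (\<lambda>x. g x * complex_of_real (h x))"
proof -
  have "h \<in> borel_measurable (bs_measure q)"
    using borel_measurable_continuous_onI[OF h] by (simp add: bs_measure_def)
  then show ?thesis
    using continuous_AE_bounded[OF q h] bs.integrable_mult_bounded[OF g] by blast
qed

lemma x_mult_bs_poly:
  "x * bs_poly q n x = (if n = 0 then bs_poly q 1 x + q * bs_poly q 0 x
     else bs_poly q (Suc n) x + bs_poly q (n - 1) x) / 2"
  by (cases n) auto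

text \<open>The Jacobi matrix of \<open>x_mult_bs_poly\<close> is symmetric, so the coefficients of
  \<open>x * g\<close> arise by applying that same matrix to the coefficients of \<open>g\<close>.
  This serves both completeness and the intertwining relation.\<close>

lemma coeff_x_mult:
  assumes g: "integrable (bs_measure q) g"
  shows "bs.coeff (\<lambda>x. g x * complex_of_real x) n = (if n = 0 then bs.coeff g 1 + q * bs.coeff g 0
     else bs.coeff g (Suc n) + bs.coeff g (n - 1)) / 2"
proof -
  have int [simp]: "integrable (bs_measure q) (\<lambda>x. g x * complex_of_real (bs_poly q m x))" for m
    by (rule bs.integrable_mult_P[OF g])
  have *: "g x * complex_of_real x * complex_of_real (bs_poly q n x)
      = g x * complex_of_real (x * bs_poly q n x)" for x
    by simp
  show ?thesis
  proof (cases "n = 0")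
    case True
    have "g x * complex_of_real x * complex_of_real (bs_poly q n x)
      = (g x * complex_of_real (bs_poly q 1 x) + q * (g x * complex_of_real (bs_poly q 0 x))) / 2" for x
      unfolding * x_mult_bs_poly using True by (simp add: algebra_simps del: bs_poly.simps)
    then have "bs.coeff (\<lambda>x. g x * complex_of_real x) n
      = (LINT x|bs_measure q. (g x * complex_of_real (bs_poly q 1 x) + q * (g x * complex_of_real (bs_poly q 0 x))) / 2)"
      by (simp only: bs.coeff_def)
    also have "\<dots> = (bs.coeff g 1 + q * bs.coeff g 0) / 2"
      by (simp add: bs.coeff_def del: bs_poly.simps)
    finally show ?thesis using True by simp
  next
    case False
    have "g x * complex_of_real x * complex_of_real (bs_poly q n x)
      = (g x * complex_of_real (bs_poly q (Suc n) x) + g x * complex_of_real (bs_poly q (n - 1) x)) / 2" for x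
      unfolding * x_mult_bs_poly using False by (simp add: algebra_simps del: bs_poly.simps)
    then have "bs.coeff (\<lambda>x. g x * complex_of_real x) n
      = (LINT x|bs_measure q. (g x * complex_of_real (bs_poly q (Suc n) x) + g x * complex_of_real (bs_poly q (n - 1) x)) / 2)"
      by (simp only: bs.coeff_def)
    also have "\<dots> = (bs.coeff g (Suc n) + bs.coeff g (n - 1)) / 2"
      by (simp add: bs.coeff_def del: bs_poly.simps)
    finally show ?thesis using False by simp
  qed
qed

text \<open>By \<open>coeff_x_mult\<close>, multiplication by \<open>x\<close> preserves the
  vanishing of all coefficients. The moment itself is the coefficient at
  \<open>P_0 = 1\<close>.\<close>

lemma integral_mult_power_eq_0:
  assumes "integrable (bs_measure q) g" "\<And>n. bs.coeff g n = 0"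
  shows "(LINT x|bs_measure q. g x * complex_of_real (x ^ i)) = 0"
proof -
  have "integrable (bs_measure q) (\<lambda>x. g x * complex_of_real (x ^ i)) \<and>
     (\<forall>n. bs.coeff (\<lambda>x. g x * complex_of_real (x ^ i)) n = 0)"
  proof (induction i)
    case (Suc i)
    have eq: "(\<lambda>x. g x * complex_of_real (x ^ Suc i)) = (\<lambda>x. (g x * complex_of_real (x ^ i)) * complex_of_real x)"
      by (simp add: mult_ac)
    have "integrable (bs_measure q) (\<lambda>x. (g x * complex_of_real (x ^ i)) * complex_of_real x)"
      by (rule integrable_mult_continuous[OF conjunct1[OF Suc.IH] continuous_on_id])
    moreover have "bs.coeff (\<lambda>x. (g x * complex_of_real (x ^ i)) * complex_of_real x) n = 0" for n
      unfolding coeff_x_mult[OF conjunct1[OF Suc.IH]] using Suc.IH by auto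
    ultimately show ?case unfolding eq by blast
  qed (use assms in auto)
  then have "bs.coeff (\<lambda>x. g x * complex_of_real (x ^ i)) 0 = 0" by blast
  then show ?thesis by (simp add: bs.coeff_def)
qed

text \<open>The measure lives on \<open>[-1,1]\<close>, so a polynomial uniformly within
  \<open>e\<close> of \<open>h\<close> there changes the integral by at most \<open>e\<close> times
  the L1 norm of \<open>g\<close>, and its own integral against \<open>g\<close> vanishes.\<close>

lemma integral_mult_continuous_eq_0:
  fixes h :: "real \<Rightarrow> real"
  assumes g: "integrable (bs_measure q) g" and 0: "\<And>n. bs.coeff g n = 0"
    and h: "continuous_on UNIV h"
  shows "(LINT x|bs_measure q. g x * complex_of_real (h x)) = 0"
proof -
  define K where "K = (LINT x|bs_measure q. cmod (g x))"
  define c where "c = cmod (LINT x|bs_measure q. g x * complex_of_real (h x))"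
  have K: "0 \<le> K" by (simp add: K_def)
  have le: "c \<le> e * K" if e: "e > 0" for e
  proof -
    obtain p where p: "real_polynomial_function p" "\<And>x. x \<in> {-1..1} \<Longrightarrow> \<bar>h x - p x\<bar> < e"
      by (rule Stone_Weierstrass_real_polynomial_function[of "{-1..1}" h e])
        (use e h in \<open>auto intro: continuous_on_subset\<close>)
    then obtain a n where pa: "p = (\<lambda>x. \<Sum>i\<le>n. a i * x ^ i)"
      unfolding real_polynomial_function_iff_sum by blast
    have cp: "continuous_on UNIV p" unfolding pa by (intro continuous_intros)
    have "(LINT x|bs_measure q. g x * complex_of_real (p x))
      = (LINT x|bs_measure q. (\<Sum>i\<le>n. complex_of_real (a i) * (g x * complex_of_real (x ^ i))))"
      by (simp add: pa sum_distrib_left mult_ac)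
    also have "\<dots> = (\<Sum>i\<le>n. complex_of_real (a i) * (LINT x|bs_measure q. g x * complex_of_real (x ^ i)))"
    proof -
      have "integrable (bs_measure q) (\<lambda>x. complex_of_real (a i) * (g x * complex_of_real (x ^ i)))" for i
        by (intro integrable_mult_right integrable_mult_continuous[OF g] continuous_intros)
      then show ?thesis
        by (subst Bochner_Integration.integral_sum) (simp_all only: integral_mult_right_zero)
    qed
    also have "\<dots> = 0" by (simp only: integral_mult_power_eq_0[OF g 0] mult_zero_right sum.neutral_const)
    finally have "(LINT x|bs_measure q. g x * complex_of_real (h x))
       = (LINT x|bs_measure q. g x * complex_of_real (h x) - g x * complex_of_real (p x))"
      using integrable_mult_continuous[OF g h] integrable_mult_continuous[OF g cp] by simp
    then have "c \<le> (LINT x|bs_measure q. cmod (g x * complex_of_real (h x) - g x * complex_of_real (p x)))"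
      unfolding c_def by simp
    also have "\<dots> \<le> (LINT x|bs_measure q. e * cmod (g x))"
    proof (rule integral_mono_AE)
      show "integrable (bs_measure q) (\<lambda>x. cmod (g x * complex_of_real (h x) - g x * complex_of_real (p x)))"
        using integrable_mult_continuous[OF g h] integrable_mult_continuous[OF g cp] by simp
      show "integrable (bs_measure q) (\<lambda>x. e * cmod (g x))" using g by auto
      show "AE x in bs_measure q. cmod (g x * complex_of_real (h x) - g x * complex_of_real (p x)) \<le> e * cmod (g x)"
        using AE_bs_measure[OF q]
      proof eventually_elim
        case (elim x)
        have "cmod (g x * complex_of_real (h x) - g x * complex_of_real (p x)) = \<bar>h x - p x\<bar> * cmod (g x)"
          by (simp add: norm_mult flip: right_diff_distrib of_real_diff)
        also have "\<dots> \<le> e * cmod (g x)"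
          using p(2)[OF elim] by (intro mult_right_mono) auto
        finally show ?case .
      qed
    qed
    finally show ?thesis by (simp add: K_def)
  qed
  have "c \<le> 0"
  proof (rule ccontr)
    assume "\<not> c \<le> 0"
    then have c: "c > 0" by simp
    \<comment> \<open>The choice \<open>e = c / (K + 1)\<close> stays meaningful when
      \<open>K = 0\<close>.\<close>
    have "c \<le> c / (K + 1) * K" using c K by (intro le) auto
    also have "\<dots> < c" using c K by (simp add: field_simps)
    finally show False by simp
  qed
  then show ?thesis by (simp add: c_def)
qed

text \<open>A function whose integral over every measurable set is 0 vanishes almost everywhere.
  Half-lines generate the Borel sets and are stable under intersection, so Dynkin's lemma reduces
  the claim to them; their indicators are limits of continuous functions.\<close>

lemma AE_eq_0_if_coeff_eq_0:
  assumes g: "integrable (bs_measure q) g" and 0: "\<And>n. bs.coeff g n = 0"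
  shows "AE x in bs_measure q. g x = 0"
proof (rule bs.density_zero[OF g])
  have [measurable]: "g \<in> borel_measurable borel"
    using borel_measurable_integrable[OF g] by (simp add: bs_measure_def)
  \<comment> \<open>The integral over the whole line, needed for complements below.\<close>
  have zero: "(LINT x|bs_measure q. g x) = 0"
    using integral_mult_continuous_eq_0[OF g 0, of "\<lambda>_. 1"] by simp
  fix A assume "A \<in> sets (bs_measure q)"
  then have A: "A \<in> sigma_sets UNIV (range (\<lambda>a::real. {..a}))"
    by (simp add: bs_measure_def borel_eq_atMost)
  have "Int_stable (range (\<lambda>a::real. {..a}))" "range (\<lambda>a::real. {..a}) \<subseteq> Pow UNIV"
    by (auto simp: Int_stable_def)
  from this A show "set_lebesgue_integral (bs_measure q) A g = 0"
  proof (induction rule: sigma_sets_induct_disjoint)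
    case (basic A)
    then obtain a where A: "A = {..a}" by auto
    \<comment> \<open>\<open>h k\<close> is 1 up to \<open>a\<close> and, for \<open>k > 0\<close>,
      falls linearly to 0 on \<open>[a, a + 1/k]\<close>.\<close>
    define h :: "nat \<Rightarrow> real \<Rightarrow> real" where "h k x = max 0 (1 - real k * max 0 (x - a))" for k x
    have cont: "continuous_on UNIV (h k)" for k
      unfolding h_def by (intro continuous_intros)
    have [measurable]: "h k \<in> borel_measurable borel" for k
      by (rule borel_measurable_continuous_onI[OF cont])
    have lim: "(\<lambda>k. h k x) \<longlonglongrightarrow> indicator A x" for x
    proof (cases "x \<le> a")
      case True
      then show ?thesis by (simp add: A h_def)
    next
      case False
      obtain k0 :: nat where k0: "1 / (x - a) < real k0" using reals_Archimedean2 by blast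
      have "h k x = 0" if "k \<ge> k0" for k
      proof -
        have "1 < real k0 * (x - a)" using k0 False by (simp add: field_simps)
        also have "\<dots> \<le> real k * (x - a)" using that False by (intro mult_right_mono) auto
        finally show ?thesis using False by (simp add: h_def)
      qed
      then have "eventually (\<lambda>k. h k x = indicator A x) sequentially"
        using False by (auto simp: A eventually_sequentially)
      then show ?thesis by (rule tendsto_eventually)
    qed
    have "(\<lambda>k. LINT x|bs_measure q. g x * complex_of_real (h k x)) \<longlonglongrightarrow> (LINT x|bs_measure q. indicat_real A x *\<^sub>R g x)"
    proof (rule integral_dominated_convergence[where w = "\<lambda>x. cmod (g x)"])
      have "A \<in> sets borel" by (simp add: A)
      then show "(\<lambda>x. indicat_real A x *\<^sub>R g x) \<in> borel_measurable (bs_measure q)"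
        using q by (simp add: sets_bs_measure cong: measurable_cong_sets) 
      show "AE x in bs_measure q. (\<lambda>k. g x * complex_of_real (h k x)) \<longlonglongrightarrow> indicat_real A x *\<^sub>R g x"
        unfolding scaleR_conv_of_real mult.commute[of _ "g _"]
        by (intro AE_I2 tendsto_mult tendsto_const tendsto_of_real lim)
      show "AE x in bs_measure q. cmod (g x * complex_of_real (h k x)) \<le> cmod (g x)" for k
        by (intro AE_I2) (auto simp: norm_mult h_def intro!: mult_left_le)
    qed (use g integrable_mult_continuous[OF g cont] in auto)
    then have "(LINT x|bs_measure q. indicat_real A x *\<^sub>R g x) = 0"
      by (simp add: integral_mult_continuous_eq_0[OF g 0 cont] LIMSEQ_const_iff)
    then show ?case by (simp add: set_lebesgue_integral_def)
  next
    case empty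
    show ?case by (simp add: set_lebesgue_integral_def)
  next
    case (compl A)
    then have A: "A \<in> sets (bs_measure q)" by (simp add: bs_measure_def borel_eq_atMost)
    have "indicat_real (UNIV - A) x *\<^sub>R g x = g x - indicat_real A x *\<^sub>R g x" for x
      by (simp add: indicator_def)
    then show ?case
      using compl zero integrable_mult_indicator[OF A g]
      by (simp add: set_lebesgue_integral_def Bochner_Integration.integral_diff[OF g])
  next
    case (union A)
    then have A: "A i \<in> sets (bs_measure q)" for i by (auto simp: bs_measure_def borel_eq_atMost)
    have "(LINT x:(\<Union>i. A i)|bs_measure q. g x) = (\<Sum>i. LINT x:A i|bs_measure q. g x)"
    proof (rule lebesgue_integral_countable_add[OF A])
      show "A i \<inter> A j = {}" if "i \<noteq> j" for i j
        using union(1) that by (auto simp: disjoint_family_on_def)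
      show "set_integrable (bs_measure q) (\<Union>i. A i) g"
        unfolding set_integrable_def using A by (intro integrable_mult_indicator g) auto
    qed
    then show ?case using union by simp
  qed
qed

lemma AE_eq_if_coeff_eq:
  assumes g: "g \<in> L2fun (bs_measure q)" and h: "h \<in> L2fun (bs_measure q)"
    and eq: "\<And>n. bs.coeff g n = bs.coeff h n"
  shows "AE x in bs_measure q. g x = h x"
proof -
  note int = bs.L2fun_integrable[OF g] bs.L2fun_integrable[OF h]
  have "AE x in bs_measure q. g x - h x = 0"
    by (rule AE_eq_0_if_coeff_eq_0) (use int eq in \<open>auto simp: bs.coeff_diff\<close>)
  then show ?thesis by simp
qed

end

section \<open>Radial functions on the tree\<close>

text \<open>The power \<open>p\<close> of \<open>s0\<close> has the value
  \<open>sqrt N ^ (-p)\<close> on each of the \<open>N ^ p\<close> words of length \<open>p\<close>.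
  Dividing by this root makes \<open>a\<close> the coordinate sequence in the orthonormal basis of
  these powers.\<close>

definition radial :: "nat \<Rightarrow> (nat \<Rightarrow> complex) \<Rightarrow> nat list \<Rightarrow> complex" where
  "radial N a u = (if u \<in> words N then a (length u) / complex_of_real (sqrt (real N)) ^ length u else 0)"

definition level :: "nat \<Rightarrow> nat \<Rightarrow> nat list set" where
  "level N n = {u. set u \<subseteq> {1..N} \<and> length u = n}"

section \<open>Sums over words, level by level\<close>

lemma finite_level [simp]: "finite (level N n)" and card_level: "card (level N n) = N ^ n"
  unfolding level_def using finite_lists_length_eq[of "{1..N}"] card_lists_length_eq[of "{1..N}"] by auto

lemma in_level_iff: "u \<in> level N n \<longleftrightarrow> u \<in> words N \<and> length u = n"
  by (auto simp: words_def level_def)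

lemma sum_UN_level: "sum f (\<Union>k<n. level N k) = (\<Sum>k<n. \<Sum>u\<in>level N k. f u)"
  by (rule sum.UNION_disjoint) (auto simp: in_level_iff)

lemma Nil_in_words [simp]: "[] \<in> words N"
  and append_in_words [simp]: "u @ v \<in> words N \<longleftrightarrow> u \<in> words N \<and> v \<in> words N"
  and single_in_words [simp]: "[i] \<in> words N \<longleftrightarrow> i \<in> {1..N}"
  by (auto simp: words_def)

lemma replicate_in_words: "N \<ge> 1 \<Longrightarrow> replicate p 1 \<in> words N"
  by (auto simp: words_def)

lemma summable_on_wordsI:
  fixes f :: "nat list \<Rightarrow> real"
  assumes nonneg: "\<And>u. 0 \<le> f u" and sm: "summable (\<lambda>n. \<Sum>u\<in>level N n. f u)"
  shows "f summable_on words N"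
proof (rule nonneg_bdd_above_summable_on)
  show "bdd_above (sum f ` {F. F \<subseteq> words N \<and> finite F})"
  proof (rule bdd_aboveI2)
    fix F assume "F \<in> {F. F \<subseteq> words N \<and> finite F}"
    then have F: "F \<subseteq> words N" "finite F" by auto
    \<comment> \<open>The inserted 0 keeps the maximum defined when \<open>F\<close> is
      empty.\<close>
    define n where "n = Suc (Max (insert 0 (length ` F)))"
    have "length u < n" if "u \<in> F" for u
      using F(2) that unfolding n_def less_Suc_eq_le by (intro Max_ge) auto
    then have "F \<subseteq> (\<Union>k<n. level N k)" using F by (auto simp: in_level_iff)
    then have "sum f F \<le> sum f (\<Union>k<n. level N k)"
      by (intro sum_mono2) (auto simp: nonneg)
    also have "\<dots> = (\<Sum>k<n. \<Sum>u\<in>level N k. f u)"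
      by (rule sum_UN_level)
    also have "\<dots> \<le> (\<Sum>k. \<Sum>u\<in>level N k. f u)"
      by (intro sum_le_suminf sm) (auto intro: sum_nonneg nonneg)
    finally show "sum f F \<le> (\<Sum>k. \<Sum>u\<in>level N k. f u)" .
  qed
qed (rule nonneg)

text \<open>The balls of words shorter than \<open>n\<close> eventually contain every finite set of
  words, so the unordered sum is the limit along them.\<close>

lemma summable_on_words_sums:
  fixes f :: "nat list \<Rightarrow> real"
  assumes "f summable_on words N"
  shows "(\<lambda>n. \<Sum>u\<in>level N n. f u) sums infsum f (words N)"
proof -
  have "filterlim (\<lambda>n. \<Union>k<n. level N k) (finite_subsets_at_top (words N)) sequentially"
  proof (rule filterlim_finite_subsets_at_top[THEN iffD2], intro allI impI)
    fix X assume X: "finite X \<and> X \<subseteq> words N"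
    define n where "n = Suc (Max (insert 0 (length ` X)))"
    have n: "length u < n" if "u \<in> X" for u
      using X that unfolding n_def less_Suc_eq_le by (intro Max_ge) auto
    show "\<forall>\<^sub>F m in sequentially. finite (\<Union>k<m. level N k) \<and> X \<subseteq> (\<Union>k<m. level N k) \<and> (\<Union>k<m. level N k) \<subseteq> words N"
      using eventually_ge_at_top[of n]
    proof eventually_elim
      case (elim m)
      then show ?case using X n by (fastforce simp: in_level_iff)
    qed
  qed
  from filterlim_compose[OF infsum_tendsto[OF assms] this]
  have "(\<lambda>n. sum f (\<Union>k<n. level N k)) \<longlonglongrightarrow> infsum f (words N)" .
  then show ?thesis by (simp add: sums_def sum_UN_level)
qed

lemma sum_level_radial:
  assumes "N \<ge> 1"
  shows "(\<Sum>u\<in>level N n. (cmod (radial N a u))\<^sup>2) = (cmod (a n))\<^sup>2"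
proof -
  have "(\<Sum>u\<in>level N n. (cmod (radial N a u))\<^sup>2) = (\<Sum>u\<in>level N n. (cmod (a n))\<^sup>2 / real N ^ n)"
  proof (rule sum.cong[OF refl])
    fix u assume "u \<in> level N n"
    then have u: "u \<in> words N" "length u = n" by (auto simp: in_level_iff)
    have "(sqrt (real N) ^ n)\<^sup>2 = real N ^ n"
      by (metis of_nat_0_le_iff power_even_eq power_mult real_sqrt_pow2 mult.commute)
    then show "(cmod (radial N a u))\<^sup>2 = (cmod (a n))\<^sup>2 / real N ^ n"
      using u by (simp add: radial_def norm_divide norm_power power_divide)
  qed
  also have "\<dots> = (cmod (a n))\<^sup>2" using assms by (simp add: card_level)
  finally show ?thesis .
qed

lemma radial_l2space:
  assumes "N \<ge> 1" "summable (\<lambda>p. (cmod (a p))\<^sup>2)"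
  shows "radial N a \<in> l2space N"
proof -
  have "(\<lambda>u. (cmod (radial N a u))\<^sup>2) summable_on words N"
    by (rule summable_on_wordsI) (use assms in \<open>auto simp: sum_level_radial\<close>)
  then show ?thesis by (simp add: l2space_def) (simp add: radial_def)
qed

lemma l2norm_radial:
  assumes "N \<ge> 1" "radial N a \<in> l2space N"
  shows "(\<lambda>p. (cmod (a p))\<^sup>2) sums (l2norm N (radial N a))\<^sup>2"
proof -
  have "(\<lambda>u. (cmod (radial N a u))\<^sup>2) summable_on words N" using assms by (simp add: l2space_def)
  from summable_on_words_sums[OF this] show ?thesis
    by (simp add: sum_level_radial[OF assms(1)] l2norm_def infsum_nonneg)
qed

text \<open>Point evaluations are continuous in the norm; this lets constancy on levels pass to the
  closure.\<close>

lemma cmod_le_l2norm: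
  assumes "v \<in> l2space N"
  shows "cmod (v u) \<le> l2norm N v"
proof (cases "u \<in> words N")
  case True
  have "(\<Sum>w\<in>{u}. (cmod (v w))\<^sup>2) \<le> infsum (\<lambda>u. (cmod (v u))\<^sup>2) (words N)"
    by (rule finite_sum_le_infsum) (use assms True in \<open>auto simp: l2space_def\<close>)
  then show ?thesis unfolding l2norm_def by (intro real_le_rsqrt) simp
next
  case False
  then show ?thesis using assms by (auto simp: l2space_def l2norm_def intro!: infsum_nonneg)
qed

section \<open>Identification of \<open>H_Omega\<close> with the radial functions\<close>

lemma tensor_pow_s0: "tensor_pow N (s0 N) p = radial N (\<lambda>n. if n = p then 1 else 0)"
proof
  fix u
  have "(\<Prod>i\<leftarrow>u. s0 N i) = (1 / complex_of_real (sqrt (real N))) ^ length u" if "set u \<subseteq> {1..N}"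
    using that by (induction u) (auto simp: s0_def)
  then show "tensor_pow N (s0 N) p u = radial N (\<lambda>n. if n = p then 1 else 0) u"
    by (auto simp: tensor_pow_def radial_def words_def power_one_over)
qed

lemma fock_Omega_radial: "fock_Omega = radial N (\<lambda>n. if n = 0 then 1 else 0)"
  by (auto simp: fock_Omega_def fock_basis_def radial_def)

lemma radial_linear: "radial N (\<lambda>p. a * f p + b * g p) u = a * radial N f u + b * radial N g u"
  by (simp add: radial_def add_divide_distrib)

text \<open>With \<open>fock_Omega\<close> as the power 0, the finite combinations in the definition
  of \<open>H_Omega\<close> become radial functions with truncated coefficient sequences.\<close>

lemma span_radial:
  "c 0 * fock_Omega u + (\<Sum>p\<in>{1..n}. c p * tensor_pow N (s0 N) p u)
    = radial N (\<lambda>p. if p \<le> n then c p else 0) u"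
proof -
  have "c 0 * fock_Omega u + (\<Sum>p\<in>{1..n}. c p * tensor_pow N (s0 N) p u)
     = (\<Sum>p\<in>{0..n}. c p * radial N (\<lambda>m. if m = p then 1 else 0) u)"
    unfolding tensor_pow_s0 fock_Omega_radial[of N] by (subst sum.atLeast_Suc_atMost) auto
  also have "\<dots> = (\<Sum>p\<in>{0..n}. if length u = p then radial N (\<lambda>p. if p \<le> n then c p else 0) u else 0)"
    by (rule sum.cong) (auto simp: radial_def)
  also have "\<dots> = radial N (\<lambda>p. if p \<le> n then c p else 0) u"
    by (auto simp: radial_def)
  finally show ?thesis .
qed

text \<open>A radial function is constant on each level, so its coefficients can be read off at the
  single word \<open>1...1\<close> of each length.\<close>

definition radial_coeff :: "nat \<Rightarrow> (nat list \<Rightarrow> complex) \<Rightarrow> nat \<Rightarrow> complex" where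
  "radial_coeff N f p = complex_of_real (sqrt (real N)) ^ p * f (replicate p 1)"

lemma radial_coeff_radial:
  assumes "N \<ge> 1"
  shows "radial_coeff N (radial N a) = a"
  using assms replicate_in_words[OF assms] by (auto simp: radial_coeff_def radial_def fun_eq_iff)

lemma summable_diff_square:
  fixes a b :: "nat \<Rightarrow> complex"
  assumes "summable (\<lambda>p. (cmod (a p))\<^sup>2)" "summable (\<lambda>p. (cmod (b p))\<^sup>2)"
  shows "summable (\<lambda>p. (cmod (a p - b p))\<^sup>2)"
proof (rule summable_comparison_test)
  show "summable (\<lambda>p. 2 * (cmod (a p))\<^sup>2 + 2 * (cmod (b p))\<^sup>2)"
    using assms by (intro summable_add summable_mult)
  have "(cmod (a p - b p))\<^sup>2 \<le> 2 * (cmod (a p))\<^sup>2 + 2 * (cmod (b p))\<^sup>2" for p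
  proof -
    have "(cmod (a p - b p))\<^sup>2 \<le> (cmod (a p) + cmod (b p))\<^sup>2"
      by (intro power_mono norm_triangle_ineq4) auto
    also have "\<dots> \<le> 2 * (cmod (a p))\<^sup>2 + 2 * (cmod (b p))\<^sup>2"
      using zero_le_power2[of "cmod (a p) - cmod (b p)"]
      unfolding power2_diff power2_sum by linarith
    finally show ?thesis .
  qed
  then show "\<exists>n0. \<forall>p\<ge>n0. norm ((cmod (a p - b p))\<^sup>2) \<le> 2 * (cmod (a p))\<^sup>2 + 2 * (cmod (b p))\<^sup>2"
    by simp
qed

lemma l2space_diff_finite:
  assumes "f \<in> l2space N" "\<And>u. u \<notin> F \<Longrightarrow> h u = 0" "finite F" "F \<subseteq> words N"
  shows "(\<lambda>u. f u - h u) \<in> l2space N"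
proof -
  have "(\<lambda>u. (cmod (f u - h u))\<^sup>2) summable_on words N"
  proof -
    have "(\<lambda>u. (cmod (f u))\<^sup>2) summable_on words N" using assms(1) by (simp add: l2space_def)
    then have "(\<lambda>u. (cmod (f u))\<^sup>2) summable_on (words N - F)"
      by (rule summable_on_subset_banach) (rule Diff_subset)
    moreover have "(\<lambda>u. (cmod (f u))\<^sup>2) summable_on (words N - F)
        \<longleftrightarrow> (\<lambda>u. (cmod (f u - h u))\<^sup>2) summable_on (words N - F)"
      by (rule summable_on_cong) (simp add: assms(2))
    ultimately have "(\<lambda>u. (cmod (f u - h u))\<^sup>2) summable_on (words N - F)" by blast
    moreover have "(\<lambda>u. (cmod (f u - h u))\<^sup>2) summable_on F"
      using assms(3) by (rule summable_on_finite)
    ultimately have "(\<lambda>u. (cmod (f u - h u))\<^sup>2) summable_on ((words N - F) \<union> F)"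
      by (intro summable_on_Un_disjoint) auto
    moreover have "(words N - F) \<union> F = words N" using assms(4) by blast
    ultimately show ?thesis by simp
  qed
  moreover have "f u - h u = 0" if "u \<notin> words N" for u
    using assms(1,4) assms(2)[of u] that by (auto simp: l2space_def)
  ultimately show ?thesis by (simp add: l2space_def)
qed

text \<open>Each approximant takes equal values at \<open>u\<close> and at the word
  \<open>1...1\<close> of the same length. Norm approximation is pointwise approximation, so
  \<open>f\<close> does too.\<close>

lemma H_Omega_imp_radial:
  assumes N: "N \<ge> 1" and f: "f \<in> H_Omega N"
  shows "f = radial N (radial_coeff N f)"
proof
  fix u
  have fl2: "f \<in> l2space N" using f by (simp add: H_Omega_def)
  show "f u = radial N (radial_coeff N f) u"
  proof (cases "u \<in> words N")
    case False
    then show ?thesis using fl2 by (simp add: l2space_def radial_def)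
  next
    case True
    define v where "v = replicate (length u) (1::nat)"
    have v: "v \<in> words N" "length v = length u" using replicate_in_words[OF N] by (auto simp: v_def)
    have "cmod (f u - f v) \<le> e" if e: "e > 0" for e
    proof -
      obtain c n where c: "l2norm N (\<lambda>u. f u - (c 0 * fock_Omega u + (\<Sum>p\<in>{1..n}. c p * tensor_pow N (s0 N) p u))) < e / 2"
        using f e half_gt_zero[OF e] unfolding H_Omega_def by blast
      define h where "h = radial N (\<lambda>p. if p \<le> n then c p else 0)"
      have "(\<lambda>u. f u - h u) \<in> l2space N"
        by (rule l2space_diff_finite[OF fl2, where F = "\<Union>k\<le>n. level N k"])
          (auto simp: h_def radial_def in_level_iff)
      from cmod_le_l2norm[OF this] have lt: "cmod (f w - h w) < e / 2" for w
        using c unfolding span_radial h_def by (meson le_less_trans)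
      have "h u = h v" using True v by (simp add: h_def radial_def)
      then show ?thesis
        using norm_triangle_ineq4[of "f u - h u" "f v - h v"] lt[of u] lt[of v] by simp
    qed
    then have "f u = f v" using field_le_epsilon[of "cmod (f u - f v)" 0] by simp
    then show ?thesis using True N by (simp add: radial_def radial_coeff_def v_def)
  qed
qed

lemma radial_in_H_Omega:
  assumes N: "N \<ge> 1" and a: "summable (\<lambda>p. (cmod (a p))\<^sup>2)"
  shows "radial N a \<in> H_Omega N"
proof -
  have "\<exists>c n. l2norm N (\<lambda>u. radial N a u - (c 0 * fock_Omega u + (\<Sum>p\<in>{1..n}. c p * tensor_pow N (s0 N) p u))) < e"
    if e: "e > 0" for e
  proof -
    have "(\<lambda>n. \<Sum>p. (cmod (a (p + n)))\<^sup>2) \<longlonglongrightarrow> 0" by (rule suminf_exist_split2[OF a])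
    then have "eventually (\<lambda>n. (\<Sum>p. (cmod (a (p + n)))\<^sup>2) < e\<^sup>2) sequentially"
      using e by (intro order_tendstoD(2)) auto
    \<comment> \<open>The tail starts at \<open>Suc n\<close> because the combination keeps the
      indices 0 to \<open>n\<close>.\<close>
    then obtain n where n: "(\<Sum>p. (cmod (a (p + Suc n)))\<^sup>2) < e\<^sup>2"
      unfolding eventually_sequentially by (meson le_SucI order_refl)
    define b where "b = (\<lambda>p. if p \<le> n then 0 else a p)"
    have b: "(\<lambda>p. (cmod (b p))\<^sup>2) sums (\<Sum>p. (cmod (a (p + Suc n)))\<^sup>2)"
    proof -
      have "(\<lambda>p. (cmod (b (p + Suc n)))\<^sup>2) sums (\<Sum>p. (cmod (a (p + Suc n)))\<^sup>2)"
        using summable_sums[OF summable_ignore_initial_segment[OF a, of "Suc n"]] by (simp add: b_def)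
      moreover have "(\<Sum>p<Suc n. (cmod (b p))\<^sup>2) = 0" by (intro sum.neutral) (auto simp: b_def)
      ultimately show ?thesis using sums_iff_shift[of "\<lambda>p. (cmod (b p))\<^sup>2" "Suc n"] by simp
    qed
    have "(\<lambda>u. radial N a u - (a 0 * fock_Omega u + (\<Sum>p\<in>{1..n}. a p * tensor_pow N (s0 N) p u))) = radial N b"
      unfolding span_radial by (auto simp: radial_def b_def fun_eq_iff)
    moreover have "(l2norm N (radial N b))\<^sup>2 < e\<^sup>2"
      using l2norm_radial[OF N radial_l2space[OF N sums_summable[OF b]]] b n sums_unique2 by metis
    then have "l2norm N (radial N b) < e" using e power_less_imp_less_base by fastforce
    ultimately show ?thesis by metis
  qed
  then show ?thesis using radial_l2space[OF assms] by (simp add: H_Omega_def)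
qed

lemma H_Omega_summable:
  assumes N: "N \<ge> 1" and f: "f \<in> H_Omega N"
  shows "(\<lambda>p. (cmod (radial_coeff N f p))\<^sup>2) sums (l2norm N f)\<^sup>2"
proof -
  have "f \<in> l2space N" using f by (simp add: H_Omega_def)
  with l2norm_radial[OF N, of "radial_coeff N f"] show ?thesis
    unfolding H_Omega_imp_radial[OF assms, symmetric] by blast
qed

text \<open>The root has \<open>N\<close> neighbours and not \<open>N + 1\<close>. The extra term
  \<open>a 0 / sqrt N\<close>, multiplied by \<open>sqrt N\<close>, lowers the diagonal entry
  \<open>N + 1\<close> to \<open>N\<close> there.\<close>

definition jacobi :: "nat \<Rightarrow> (nat \<Rightarrow> complex) \<Rightarrow> nat \<Rightarrow> complex" where
  "jacobi N a p = of_nat (N + 1) * a p - complex_of_real (sqrt (real N)) *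
     (if p = 0 then a 1 + complex_of_real (1 / sqrt (real N)) * a 0 else a (Suc p) + a (p - 1))"

text \<open>At length \<open>n > 0\<close>, with \<open>r = sqrt N\<close>, the
  \<open>N = r * r\<close> children and the parent contribute after multiplication by
  \<open>r ^ n\<close> the terms \<open>r * r * a n - r * a (n + 1)\<close> and
  \<open>a n - r * a (n - 1)\<close>. The root has only the children.\<close>

lemma laplacian_radial:
  assumes N: "N \<ge> 1"
  shows "fock_W N (tree_laplacian N (fock_W_adj N (radial N a))) = radial N (jacobi N a)"
proof
  fix x
  have W: "fock_W_adj N (radial N a) = radial N a" by (auto simp: fock_W_adj_def radial_def)
  define r where "r = complex_of_real (sqrt (real N))"
  have r: "r \<noteq> 0" "of_nat N = r * r"
    using N by (auto simp: r_def simp flip: of_real_mult)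
  show "fock_W N (tree_laplacian N (fock_W_adj N (radial N a))) x = radial N (jacobi N a) x"
  proof (cases "x \<in> words N")
    case True
    define n where "n = length x"
    have "(\<Sum>i\<in>{1..N}. radial N a x - radial N a (x @ [i])) = (\<Sum>i\<in>{1..N}. a n / r ^ n - a (Suc n) / r ^ Suc n)"
      using True by (intro sum.cong) (auto simp: radial_def n_def r_def)
    then have 1: "(\<Sum>i\<in>{1..N}. radial N a x - radial N a (x @ [i])) = r * r * (a n / r ^ n - a (Suc n) / r ^ Suc n)"
      by (simp add: r(2))
    have J: "jacobi N a p = (r * r + 1) * a p - r * (if p = 0 then a 1 + a 0 / r else a (Suc p) + a (p - 1))" for p
      unfolding jacobi_def of_nat_add of_nat_1 r(2) by (simp add: r_def)
    have L: "fock_W N (tree_laplacian N (fock_W_adj N (radial N a))) x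
      = r * r * (a n / r ^ n - a (Suc n) / r ^ Suc n) + (if x = [] then 0 else radial N a x - radial N a (butlast x))"
      unfolding W fock_W_def tree_laplacian_def 1 using True by simp
    have R: "radial N (jacobi N a) x = jacobi N a n / r ^ n"
      using True by (simp add: radial_def n_def r_def)
    show ?thesis
    proof (cases "x = []")
      case True
      then have "n = 0" by (simp add: n_def)
      then show ?thesis unfolding L R J using True r(1) by (simp add: algebra_simps)
    next
      case False
      then obtain y i where x: "x = y @ [i]" by (metis rev_exhaust)
      define m where "m = length y"
      have n: "n = Suc m" by (simp add: n_def m_def x)
      have "radial N a x = a (Suc m) / r ^ Suc m" "radial N a (butlast x) = a m / r ^ m"
        using True by (auto simp: x radial_def m_def r_def)
      then show ?thesis unfolding L R J using False r(1) by (simp add: n field_simps)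
    qed
  qed (simp add: fock_W_def radial_def)
qed

lemma summable_jacobi:
  assumes a: "summable (\<lambda>p. (cmod (a p))\<^sup>2)"
  shows "summable (\<lambda>p. (cmod (jacobi N a p))\<^sup>2)"
proof -
  have scale: "summable (\<lambda>p. (cmod (c * b p))\<^sup>2)" if "summable (\<lambda>p. (cmod (b p))\<^sup>2)" for c and b :: "nat \<Rightarrow> complex"
    using summable_mult[OF that, of "(cmod c)\<^sup>2"] by (simp add: norm_mult power_mult_distrib)
  define r where "r = complex_of_real (sqrt (real N))"
  \<comment> \<open>The sequence shifted by one, with the diagonal correction of the root in
    position 0; this merges the two cases of \<open>jacobi\<close>.\<close>
  define b where "b = (\<lambda>p. if p = 0 then complex_of_real (1 / sqrt (real N)) * a 0 else a (p - 1))"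
  have b: "summable (\<lambda>p. (cmod (b p))\<^sup>2)"
    using a by (subst summable_Suc_iff[symmetric]) (simp add: b_def)
  have s: "summable (\<lambda>p. (cmod (a (Suc p)))\<^sup>2)"
    using a by (subst summable_Suc_iff)
  have "jacobi N a = (\<lambda>p. (of_nat (N + 1) * a p - r * a (Suc p)) - r * b p)"
    by (auto simp: jacobi_def b_def r_def algebra_simps fun_eq_iff)
  then show ?thesis
    by (simp only:) (intro summable_diff_square scale a b s)
qed

section \<open>The unitary equivalence\<close>

lemma mu_cp_eq_bs_measure: "mu_cp N = bs_measure (1 / sqrt (real N))"
proof -
  have "(\<lambda>x. indicator {-1..1} x *
      ennreal ((2 / pi) * sqrt (1 - x\<^sup>2) / (1 - 2 * x / sqrt (real N) + 1 / real N)))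
    = (\<lambda>x. ennreal (bs_weight (1 / sqrt (real N)) x))"
    by (auto simp: fun_eq_iff bs_weight_def indicator_def power_divide)
  then show ?thesis by (simp add: mu_cp_def bs_measure_def)
qed

theorem theorem3p21:
  fixes N :: nat
  assumes "N \<ge> 1"
  shows "unitarily_equiv_mult N (H_Omega N)
           (\<lambda>f. fock_W N (tree_laplacian N (fock_W_adj N f)))
           (mu_cp N) (\<lambda>x. real N + 1 - 2 * sqrt (real N) * x)"
proof -
  define q where "q = 1 / sqrt (real N)"
  have q: "0 < q" "q \<le> 1" using assms by (auto simp: q_def)
  define M where "M = bs_measure q"
  interpret bs: orthonormal_system M "bs_poly q"
    unfolding M_def by (rule orthonormal_system_bs[OF q])
  define T where "T = (\<lambda>f. fock_W N (tree_laplacian N (fock_W_adj N f)))"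
  define m where "m = (\<lambda>x. real N + 1 - 2 * sqrt (real N) * x)"
  note unique = AE_eq_if_coeff_eq[OF q, folded M_def]
  note rc = radial_coeff_radial[OF assms]
  have sm: "summable (\<lambda>p. (cmod (radial_coeff N f p))\<^sup>2)" if "f \<in> H_Omega N" for f
    using H_Omega_summable[OF assms that] by (rule sums_summable)
  have T: "T f = radial N (jacobi N (radial_coeff N f))" if "f \<in> H_Omega N" for f
    using laplacian_radial[OF assms, of "radial_coeff N f"] H_Omega_imp_radial[OF assms that]
    by (simp add: T_def)
  have T_in: "T f \<in> H_Omega N" if "f \<in> H_Omega N" for f
    unfolding T[OF that] by (intro radial_in_H_Omega[OF assms] summable_jacobi sm[OF that])
  \<comment> \<open>\<open>U f\<close> is an arbitrarily chosen representative with the prescribed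
    coefficients, so linearity and intertwining can only hold almost everywhere.\<close>
  have "\<forall>f\<in>H_Omega N. \<exists>g. g \<in> L2fun M \<and> (\<forall>p. bs.coeff g p = radial_coeff N f p)
      \<and> (LINT x|M. (cmod (g x))\<^sup>2) = (\<Sum>p. (cmod (radial_coeff N f p))\<^sup>2)"
    using bs.riesz_fischer[OF sm] by blast
  from bchoice[OF this] obtain U where U: "\<And>f. f \<in> H_Omega N \<Longrightarrow> U f \<in> L2fun M
      \<and> (\<forall>p. bs.coeff (U f) p = radial_coeff N f p)
      \<and> (LINT x|M. (cmod (U f x))\<^sup>2) = (\<Sum>p. (cmod (radial_coeff N f p))\<^sup>2)"
    by blast
  have U_L2: "U f \<in> L2fun M" and U_coeff: "bs.coeff (U f) p = radial_coeff N f p"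
    if "f \<in> H_Omega N" for f p using U[OF that] by auto
  have linear: "AE x in M. U (\<lambda>u. a * f u + b * g u) x = a * U f x + b * U g x"
    if f: "f \<in> H_Omega N" and g: "g \<in> H_Omega N" for f g a b
  proof -
    let ?h = "\<lambda>u. a * f u + b * g u" and ?c = "\<lambda>p. a * radial_coeff N f p + b * radial_coeff N g p"
    have h: "?h = radial N ?c"
      using H_Omega_imp_radial[OF assms f] H_Omega_imp_radial[OF assms g]
      by (auto simp: radial_linear fun_eq_iff)
    have c: "bs.coeff (\<lambda>x. a * U f x + b * U g x) p = ?c p" for p
      using f g by (simp add: bs.coeff_linear bs.L2fun_integrable U_L2 U_coeff)
    have L2: "(\<lambda>x. a * U f x + b * U g x) \<in> L2fun M"
      by (intro bs.L2fun_linear U_L2 f g)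
    \<comment> \<open>Square summability of \<open>?c\<close> comes from Bessel, since
      \<open>?c\<close> is the coefficient sequence of \<open>a * U f + b * U g\<close>.\<close>
    have "?h \<in> H_Omega N"
      unfolding h using radial_in_H_Omega[OF assms bs.summable_coeff_square[OF L2]] unfolding c .
    moreover have "radial_coeff N ?h = ?c" unfolding h by (rule rc)
    ultimately show ?thesis
      by (intro unique L2 U_L2) (simp_all add: U_coeff c)
  qed
  have isometry: "(LINT x|M. (cmod (U f x))\<^sup>2) = (l2norm N f)\<^sup>2" if "f \<in> H_Omega N" for f
    using U[OF that] sums_unique[OF H_Omega_summable[OF assms that]] by simp
  have surj: "\<exists>f\<in>H_Omega N. AE x in M. U f x = g x" if g: "g \<in> L2fun M" for g
  proof
    show f: "radial N (bs.coeff g) \<in> H_Omega N"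
      by (rule radial_in_H_Omega[OF assms bs.summable_coeff_square[OF g]])
    show "AE x in M. U (radial N (bs.coeff g)) x = g x"
      by (rule unique[OF U_L2[OF f] g]) (simp add: U_coeff[OF f] rc)
  qed
  have m_bounded: "\<exists>C. AE x in M. \<bar>m x\<bar> \<le> C"
    unfolding M_def m_def by (intro continuous_AE_bounded[OF q] continuous_intros)
  have intertwine: "AE x in M. U (T f) x = complex_of_real (m x) * U f x" if f: "f \<in> H_Omega N" for f
  proof (rule unique[OF U_L2[OF T_in[OF f]]])
    have [measurable]: "m \<in> borel_measurable M" unfolding m_def M_def bs_measure_def by measurable
    show "(\<lambda>x. complex_of_real (m x) * U f x) \<in> L2fun M"
      using m_bounded bs.L2fun_mult_bounded[OF U_L2[OF f]] by auto
    fix n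
    have int: "integrable M (U f)" by (rule bs.L2fun_integrable[OF U_L2[OF f]])
    have int_x: "integrable M (\<lambda>x. U f x * complex_of_real x)"
      using integrable_mult_continuous[OF q int[unfolded M_def] continuous_on_id] by (simp add: M_def)
    have "(\<lambda>x. complex_of_real (m x) * U f x) = (\<lambda>x. complex_of_real (real N + 1) * U f x
        + complex_of_real (- 2 * sqrt (real N)) * (U f x * complex_of_real x))"
      by (simp add: fun_eq_iff m_def algebra_simps)
    then have "bs.coeff (\<lambda>x. complex_of_real (m x) * U f x) n = complex_of_real (real N + 1) * bs.coeff (U f) n
        + complex_of_real (- 2 * sqrt (real N)) * bs.coeff (\<lambda>x. U f x * complex_of_real x) n"
      by (simp only: bs.coeff_linear[OF int int_x])
    also have "\<dots> = jacobi N (radial_coeff N f) n"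
    proof -
      \<comment> \<open>\<open>X\<close> is the bracket common to \<open>coeff_x_mult\<close> and
        \<open>jacobi\<close>; the factor 2 in \<open>m\<close> cancels the halving in
        \<open>coeff_x_mult\<close>.\<close>
      define X where "X = (if n = 0 then radial_coeff N f 1 + complex_of_real q * radial_coeff N f 0
           else radial_coeff N f (Suc n) + radial_coeff N f (n - 1))"
      have X: "bs.coeff (\<lambda>x. U f x * complex_of_real x) n = X / 2"
        using coeff_x_mult[OF q int[unfolded M_def], of n] unfolding M_def[symmetric] U_coeff[OF f] X_def .
      have J: "jacobi N (radial_coeff N f) n
          = of_nat (N + 1) * radial_coeff N f n - complex_of_real (sqrt (real N)) * X"
        unfolding jacobi_def X_def q_def ..
      show ?thesis unfolding X J U_coeff[OF f] by simp
    qed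
    finally show "bs.coeff (U (T f)) n = bs.coeff (\<lambda>x. complex_of_real (m x) * U f x) n"
      unfolding U_coeff[OF T_in[OF f]] unfolding T[OF f] rc by simp
  qed
  show ?thesis
    unfolding unitarily_equiv_mult_def mu_cp_eq_bs_measure q_def[symmetric] M_def[symmetric]
      T_def[symmetric] m_def[symmetric]
    by (intro conjI exI[of _ U] ballI allI T_in U_L2 linear isometry surj intertwine)
qed

end
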